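(* There are (i) an irreducible $C$-group $\tilde G$, and (ii) a Hurwitz $C$-group $G$ of degree three for which $G/G'\simeq\mathbb Z^2$, such that $\tilde G$, $G$, and the projective Hurwitz groups $\bar G_{3,k}$, $k\in\mathbb N$, associated with $G$, are non-Hopfian. In particular, they are not residually finite groups.
   Context: $C$-groups. A $C$-group is a group $G$ given by a finite presentation of the form $$G_W=\langle x_1,\dots,x_m\mid x_i=w_{i,j,k}^{-1}x_jw_{i,j,k},\ (i,j,k)\in J\rangle,$$ where $m$ is a positive integer, $J=\{(i,j,k)\in\mathbb Z^3\mid 1\le i,j\le m,\ 1\le k\le h(i,j)\}$ for some function $h:\{1,\dots,m\}^2\to\mathbb Z$, and $W=\{w_{i,j,k}\mid (i,j,k)\in J\}$ is a set of words in the free group $\mathbb F_m$ on $x_1,\dots,x_m$ (the words $w_{i,j,k}$ may coincide for distinct indices). The images of $x_1,\dots,x_m$ in $G_W$ and all their conjugates are called the $C$-generators of $G_W$. $C$-groups are considered up to $C$-isomorphism, i.e. up to isomorphisms that, together with their inverses, send $C$-generators to $C$-generators. $G'=[G,G]$ denotes the commutator subgroup. A $C$-group $G$ is irreducible if $G/G'\simeq\mathbb Z$. A Hurwitz $C$-group of degree $m$ is a $C$-group $G$ possessing a finite presentation of the form $G_W=\langle x_1,\dots,x_m\mid x_i=w_{i,j,k}^{-1}x_jw_{i,j,k},\ (i,j,k)\in J\rangle$ (with $J$ a finite index set of the form $\{(i,j,k)\in\mathbb Z^3\mid 1\le i,j\le m,\ 1\le k\le h(i,j)\}$ for some function $h:\{1,\dots,m\}^2\to\mathbb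 Z$, and $W=\{w_{i,j,k}\}$ a set of words in the free group $\mathbb F_m$ on $x_1,\dots,x_m$) whose $C$-generators $x_1,\dots,x_m$ generate $G$ and are such that the product $x_1x_2\cdots x_m$ belongs to the center of $G$ (the degree depends on the presentation). For a Hurwitz $C$-group $G=G_W$ of degree $m$ given by such a presentation and $k\in\mathbb N$, the associated projective Hurwitz group (of degree $mk$) is the quotient $\bar G_{m,k}=G_W/\{(x_1\cdots x_m)^k=1\}$, i.e. the quotient of $G_W$ by the normal closure of $(x_1\cdots x_m)^k$. A group is Hopfian if every surjective endomorphism of it is an isomorphism. *)

theory Defs
  imports "HOL-Algebra.Algebra"
begin

section \<open>General group theory\<close>

definition center :: "('a, 'b) monoid_scheme \<Rightarrow> 'a set" where
  "center G = {z \<in> carrier G. \<forall>g \<in> carrier G. z \<otimes>\<^bsub>G\<^esub> g = g \<otimes>\<^bsub>G\<^esub> z}"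

definition normal_closure :: "('a, 'b) monoid_scheme \<Rightarrow> 'a set \<Rightarrow> 'a set" where
  "normal_closure G R =
     generate G (\<Union>g \<in> carrier G. (\<lambda>r. g \<otimes>\<^bsub>G\<^esub> r \<otimes>\<^bsub>G\<^esub> inv\<^bsub>G\<^esub> g) ` R)"

definition abelianization :: "('a, 'b) monoid_scheme \<Rightarrow> 'a set monoid" where
  "abelianization G = G Mod derived G (carrier G)"

definition Hopfian :: "('a, 'b) monoid_scheme \<Rightarrow> bool" where
  "Hopfian G \<longleftrightarrow> (\<forall>f \<in> epi G G. f \<in> iso G G)"

definition residually_finite :: "('a, 'b) monoid_scheme \<Rightarrow> bool" where
  "residually_finite G \<longleftrightarrow>
     (\<forall>g \<in> carrier G. g \<noteq> \<one>\<^bsub>G\<^esub> \<longrightarrow>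
        (\<exists>N. N \<lhd> G \<and> finite (carrier (G Mod N)) \<and> g \<notin> N))"

lemma (in group) normal_closure_normal:
  assumes "R \<subseteq> carrier G"
  shows "normal_closure G R \<lhd> G"
  unfolding normal_closure_def
proof (rule normal_generateI)
  show "(\<Union>g\<in>carrier G. (\<lambda>r. g \<otimes> r \<otimes> inv g) ` R) \<subseteq> carrier G"
    using assms by auto
next
  fix h g
  assume "h \<in> (\<Union>g\<in>carrier G. (\<lambda>r. g \<otimes> r \<otimes> inv g) ` R)" and g: "g \<in> carrier G"
  then obtain a r where ar: "a \<in> carrier G" "r \<in> R" "h = a \<otimes> r \<otimes> inv a" by auto
  have "g \<otimes> h \<otimes> inv g = (g \<otimes> a) \<otimes> r \<otimes> inv (g \<otimes> a)"
    using ar g assms by (auto simp: m_assoc inv_mult_group subset_iff)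
  then show "g \<otimes> h \<otimes> inv g \<in> (\<Union>g\<in>carrier G. (\<lambda>r. g \<otimes> r \<otimes> inv g) ` R)"
    using ar g by blast
qed

section \<open>Free groups\<close>

text \<open>Words are lists of letters; the letter \<open>(x, False)\<close> stands for the generator \<open>x\<close> and
  \<open>(x, True)\<close> for its inverse.  The free group consists of the classes of words under the
  equivalence generated by deleting a pair of adjacent mutually inverse letters.\<close>

inductive cancel_step :: "'a set \<Rightarrow> ('a \<times> bool) list \<Rightarrow> ('a \<times> bool) list \<Rightarrow> bool" for S where
  "\<lbrakk>u \<in> lists (S \<times> UNIV); v \<in> lists (S \<times> UNIV); x \<in> S\<rbrakk>
     \<Longrightarrow> cancel_step S (u @ [(x, b), (x, \<not> b)] @ v) (u @ v)"

definition free_rel :: "'a set \<Rightarrow> (('a \<times> bool) list \<times> ('a \<times> bool) list) set" where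
  "free_rel S = {(u, v). u \<in> lists (S \<times> UNIV) \<and> v \<in> lists (S \<times> UNIV)
                         \<and> equivclp (cancel_step S) u v}"

definition free_group :: "'a set \<Rightarrow> ('a \<times> bool) list set monoid" where
  "free_group S =
     \<lparr>carrier = lists (S \<times> UNIV) // free_rel S,
      monoid.mult = (\<lambda>A B. \<Union>a \<in> A. \<Union>b \<in> B. free_rel S `` {a @ b}),
      one = free_rel S `` {[]}\<rparr>"

definition free_gen :: "'a set \<Rightarrow> 'a \<Rightarrow> ('a \<times> bool) list set" where
  "free_gen S x = free_rel S `` {[(x, False)]}"

lemma equiv_free_rel: "equiv (lists (S \<times> UNIV)) (free_rel S)"
  unfolding free_rel_def
  by (rule equivI) (auto simp: refl_on_def sym_def trans_def
        intro: equivclp_sym equivclp_trans)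

lemma equivclp_cancel_append:
  assumes "equivclp (cancel_step S) u v" "a \<in> lists (S \<times> UNIV)" "c \<in> lists (S \<times> UNIV)"
  shows "equivclp (cancel_step S) (a @ u @ c) (a @ v @ c)"
  using assms(1)
proof (induction rule: equivclp_induct)
  case base
  then show ?case by simp
next
  case (step y z)
  have *: "cancel_step S (a @ p @ c) (a @ q @ c)" if "cancel_step S p q" for p q
    using that
  proof cases
    case (1 u' v' x b)
    then show ?thesis
      using cancel_step.intros[of "a @ u'" S "v' @ c" x b] assms(2,3) by simp
  qed
  have "equivclp (cancel_step S) (a @ y @ c) (a @ z @ c)"
    using step(2) * by (meson converse_r_into_equivclp r_into_equivclp)
  with step.IH show ?case by (rule equivclp_trans)
qed

lemma free_rel_append:
  assumes "(u, u') \<in> free_rel S" "(v, v') \<in> free_rel S"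
  shows "(u @ v, u' @ v') \<in> free_rel S"
proof -
  have "equivclp (cancel_step S) (u @ v) (u' @ v)"
    using assms equivclp_cancel_append[of S u u' "[]" v] by (auto simp: free_rel_def)
  moreover have "equivclp (cancel_step S) (u' @ v) (u' @ v')"
    using assms equivclp_cancel_append[of S v v' u' "[]"] by (auto simp: free_rel_def)
  ultimately show ?thesis
    using assms by (auto simp: free_rel_def intro: equivclp_trans)
qed

lemma free_group_mult_class:
  assumes "u \<in> lists (S \<times> UNIV)" "v \<in> lists (S \<times> UNIV)"
  shows "(free_rel S `` {u}) \<otimes>\<^bsub>free_group S\<^esub> (free_rel S `` {v}) = free_rel S `` {u @ v}"
proof -
  have "congruent2 (free_rel S) (free_rel S) (\<lambda>a b. free_rel S `` {a @ b})"
    unfolding congruent2_def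
    using equiv_class_eq[OF equiv_free_rel] free_rel_append by blast
  then show ?thesis
    using UN_equiv_class2[OF equiv_free_rel equiv_free_rel _ assms] by (simp add: free_group_def)
qed

definition inv_word :: "('a \<times> bool) list \<Rightarrow> ('a \<times> bool) list" where
  "inv_word u = rev (map (\<lambda>(x, b). (x, \<not> b)) u)"

lemma inv_word_cancel:
  assumes "u \<in> lists (S \<times> UNIV)"
  shows "(inv_word u @ u, []) \<in> free_rel S"
  using assms
proof (induction rule: lists.induct)
  case Nil
  then show ?case by (simp add: inv_word_def free_rel_def)
next
  case (Cons l u)
  obtain x b where l: "l = (x, b)" by (cases l)
  have "l \<in> S \<times> UNIV" and u: "u \<in> lists (S \<times> UNIV)"
    using Cons.hyps by simp_all
  then have x: "x \<in> S" by (simp add: l)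
  have iu: "inv_word u \<in> lists (S \<times> UNIV)" using u by (auto simp: inv_word_def)
  have "cancel_step S (inv_word u @ [(x, \<not> b), (x, \<not> \<not> b)] @ u) (inv_word u @ u)"
    by (rule cancel_step.intros[OF iu u x])
  then have "equivclp (cancel_step S) (inv_word (l # u) @ l # u) (inv_word u @ u)"
    by (simp add: inv_word_def l r_into_equivclp)
  moreover have "equivclp (cancel_step S) (inv_word u @ u) []"
    using Cons.IH by (simp add: free_rel_def)
  ultimately show ?case
    using x u iu by (auto simp: free_rel_def l inv_word_def intro: equivclp_trans)
qed

lemma group_free_group: "group (free_group S)"
proof (rule groupI)
  let ?W = "lists (S \<times> (UNIV :: bool set))"
  let ?c = "\<lambda>u. free_rel S `` {u}"
  have carr: "carrier (free_group S) = ?c ` ?W"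
    by (auto simp: free_group_def quotient_def)
  have one: "\<one>\<^bsub>free_group S\<^esub> = ?c []" by (simp add: free_group_def)
  show "\<one>\<^bsub>free_group S\<^esub> \<in> carrier (free_group S)"
    unfolding carr one by blast
  fix A assume "A \<in> carrier (free_group S)"
  then obtain u where u: "u \<in> ?W" and A: "A = ?c u" by (auto simp: carr)
  show "\<one>\<^bsub>free_group S\<^esub> \<otimes>\<^bsub>free_group S\<^esub> A = A"
    using u by (simp add: A one free_group_mult_class)
  have iu: "inv_word u \<in> ?W" using u by (auto simp: inv_word_def)
  have "?c (inv_word u) \<otimes>\<^bsub>free_group S\<^esub> A = \<one>\<^bsub>free_group S\<^esub>"
    unfolding A one free_group_mult_class[OF iu u]
    by (rule equiv_class_eq[OF equiv_free_rel inv_word_cancel[OF u]])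
  then show "\<exists>y\<in>carrier (free_group S). y \<otimes>\<^bsub>free_group S\<^esub> A = \<one>\<^bsub>free_group S\<^esub>"
    using iu unfolding carr by blast
  fix B assume "B \<in> carrier (free_group S)"
  then obtain v where v: "v \<in> ?W" and B: "B = ?c v" by (auto simp: carr)
  have uv: "u @ v \<in> ?W" using u v by simp
  show "A \<otimes>\<^bsub>free_group S\<^esub> B \<in> carrier (free_group S)"
    unfolding A B free_group_mult_class[OF u v] carr using uv by blast
  fix C assume "C \<in> carrier (free_group S)"
  then obtain w where w: "w \<in> ?W" and C: "C = ?c w" by (auto simp: carr)
  have vw: "v @ w \<in> ?W" using v w by simp
  show "A \<otimes>\<^bsub>free_group S\<^esub> B \<otimes>\<^bsub>free_group S\<^esub> C = A \<otimes>\<^bsub>free_group S\<^esub> (B \<otimes>\<^bsub>free_group S\<^esub> C)"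
    unfolding A B C free_group_mult_class[OF u v] free_group_mult_class[OF v w]
      free_group_mult_class[OF uv w] free_group_mult_class[OF u vw] by simp
qed

lemma free_gen_carrier: "x \<in> S \<Longrightarrow> free_gen S x \<in> carrier (free_group S)"
  by (auto simp: free_gen_def free_group_def intro: quotientI)

section \<open>C-groups\<close>

text \<open>The data of a C-presentation are \<open>m\<close>, \<open>h\<close> and the family \<open>w\<close> of elements of the free group
  on \<open>1, \<dots>, m\<close>; only the values of \<open>h\<close> and \<open>w\<close> at indices in range matter.\<close>

abbreviation FG :: "nat \<Rightarrow> (nat \<times> bool) list set monoid" where
  "FG m \<equiv> free_group {1..m}"

definition C_index :: "nat \<Rightarrow> (nat \<Rightarrow> nat \<Rightarrow> int) \<Rightarrow> (nat \<times> nat \<times> int) set" where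
  "C_index m h = {(i, j, k). i \<in> {1..m} \<and> j \<in> {1..m} \<and> 1 \<le> k \<and> k \<le> h i j}"

definition C_presentation ::
  "nat \<Rightarrow> (nat \<Rightarrow> nat \<Rightarrow> int) \<Rightarrow> (nat \<Rightarrow> nat \<Rightarrow> int \<Rightarrow> (nat \<times> bool) list set) \<Rightarrow> bool" where
  "C_presentation m h w \<longleftrightarrow> 0 < m \<and> (\<forall>(i, j, k) \<in> C_index m h. w i j k \<in> carrier (FG m))"

text \<open>The relation $x_i = w_{i,j,k}^{-1} x_j w_{i,j,k}$ is encoded by the relator
  $x_i^{-1} w_{i,j,k}^{-1} x_j w_{i,j,k}$.\<close>

definition C_relators ::
  "nat \<Rightarrow> (nat \<Rightarrow> nat \<Rightarrow> int) \<Rightarrow> (nat \<Rightarrow> nat \<Rightarrow> int \<Rightarrow> (nat \<times> bool) list set)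
     \<Rightarrow> (nat \<times> bool) list set set" where
  "C_relators m h w =
     (\<lambda>(i, j, k). inv\<^bsub>FG m\<^esub> (free_gen {1..m} i) \<otimes>\<^bsub>FG m\<^esub>
        (inv\<^bsub>FG m\<^esub> (w i j k) \<otimes>\<^bsub>FG m\<^esub> free_gen {1..m} j \<otimes>\<^bsub>FG m\<^esub> w i j k)) ` C_index m h"

definition C_group ::
  "nat \<Rightarrow> (nat \<Rightarrow> nat \<Rightarrow> int) \<Rightarrow> (nat \<Rightarrow> nat \<Rightarrow> int \<Rightarrow> (nat \<times> bool) list set)
     \<Rightarrow> (nat \<times> bool) list set set monoid" where
  "C_group m h w = FG m Mod normal_closure (FG m) (C_relators m h w)"

definition C_gen ::
  "nat \<Rightarrow> (nat \<Rightarrow> nat \<Rightarrow> int) \<Rightarrow> (nat \<Rightarrow> nat \<Rightarrow> int \<Rightarrow> (nat \<times> bool) list set)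
     \<Rightarrow> nat \<Rightarrow> (nat \<times> bool) list set set" where
  "C_gen m h w i = normal_closure (FG m) (C_relators m h w) #>\<^bsub>FG m\<^esub> free_gen {1..m} i"

definition C_product ::
  "nat \<Rightarrow> (nat \<Rightarrow> nat \<Rightarrow> int) \<Rightarrow> (nat \<Rightarrow> nat \<Rightarrow> int \<Rightarrow> (nat \<times> bool) list set)
     \<Rightarrow> (nat \<times> bool) list set set" where
  "C_product m h w =
     foldr (\<otimes>\<^bsub>C_group m h w\<^esub>) (map (C_gen m h w) [1..<Suc m]) \<one>\<^bsub>C_group m h w\<^esub>"

definition irreducible_C_presentation ::
  "nat \<Rightarrow> (nat \<Rightarrow> nat \<Rightarrow> int) \<Rightarrow> (nat \<Rightarrow> nat \<Rightarrow> int \<Rightarrow> (nat \<times> bool) list set) \<Rightarrow> bool" where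
  "irreducible_C_presentation m h w \<longleftrightarrow>
     C_presentation m h w \<and> abelianization (C_group m h w) \<cong> integer_group"

definition Hurwitz_C_presentation ::
  "nat \<Rightarrow> (nat \<Rightarrow> nat \<Rightarrow> int) \<Rightarrow> (nat \<Rightarrow> nat \<Rightarrow> int \<Rightarrow> (nat \<times> bool) list set) \<Rightarrow> bool" where
  "Hurwitz_C_presentation m h w \<longleftrightarrow>
     C_presentation m h w \<and>
     generate (C_group m h w) (C_gen m h w ` {1..m}) = carrier (C_group m h w) \<and>
     C_product m h w \<in> center (C_group m h w)"

definition projective_Hurwitz_group ::
  "nat \<Rightarrow> (nat \<Rightarrow> nat \<Rightarrow> int) \<Rightarrow> (nat \<Rightarrow> nat \<Rightarrow> int \<Rightarrow> (nat \<times> bool) list set) \<Rightarrow> nat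
     \<Rightarrow> (nat \<times> bool) list set set set monoid" where
  "projective_Hurwitz_group m h w k =
     C_group m h w Mod
       normal_closure (C_group m h w) {C_product m h w [^]\<^bsub>C_group m h w\<^esub> k}"

lemma C_relators_carrier:
  assumes "C_presentation m h w"
  shows "C_relators m h w \<subseteq> carrier (FG m)"
proof -
  interpret F: group "FG m" by (rule group_free_group)
  show ?thesis
    unfolding C_relators_def
  proof (intro image_subsetI, clarify)
    fix i j k assume ijk: "(i, j, k) \<in> C_index m h"
    then have "i \<in> {1..m}" "j \<in> {1..m}" by (simp_all add: C_index_def)
    moreover have "w i j k \<in> carrier (FG m)"
      using assms ijk unfolding C_presentation_def by blast
    ultimately show "inv\<^bsub>FG m\<^esub> (free_gen {1..m} i) \<otimes>\<^bsub>FG m\<^esub>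
        (inv\<^bsub>FG m\<^esub> (w i j k) \<otimes>\<^bsub>FG m\<^esub> free_gen {1..m} j \<otimes>\<^bsub>FG m\<^esub> w i j k) \<in> carrier (FG m)"
      by (intro F.m_closed F.inv_closed free_gen_carrier)
  qed
qed

lemma group_C_group:
  assumes "C_presentation m h w"
  shows "group (C_group m h w)"
  unfolding C_group_def
  by (intro normal.factorgroup_is_group group.normal_closure_normal group_free_group
      C_relators_carrier assms)

lemma C_gen_carrier:
  assumes "i \<in> {1..m}"
  shows "C_gen m h w i \<in> carrier (C_group m h w)"
  using free_gen_carrier[OF assms]
  by (auto simp: C_gen_def C_group_def carrier_FactGroup)

lemma C_product_carrier:
  assumes "C_presentation m h w"
  shows "C_product m h w \<in> carrier (C_group m h w)"
proof -
  interpret G: group "C_group m h w" by (rule group_C_group[OF assms])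
  have "foldr (\<otimes>\<^bsub>C_group m h w\<^esub>) (map (C_gen m h w) is) \<one>\<^bsub>C_group m h w\<^esub>
          \<in> carrier (C_group m h w)" if "set is \<subseteq> {1..m}" for "is"
    using that by (induction "is") (auto intro!: G.m_closed C_gen_carrier)
  from this[of "[1..<Suc m]"] show ?thesis
    unfolding C_product_def by fastforce
qed

lemma group_projective_Hurwitz_group:
  assumes "C_presentation m h w"
  shows "group (projective_Hurwitz_group m h w k)"
proof -
  interpret G: group "C_group m h w" by (rule group_C_group[OF assms])
  show ?thesis
    unfolding projective_Hurwitz_group_def
    by (intro normal.factorgroup_is_group G.normal_closure_normal)
       (simp add: C_product_carrier[OF assms])
qed

end

theory Submission
  imports Defs
begin

text \<open>The group $B = \langle a, t \mid t a^2 t^{-1} = a^3 \rangle$ is non-Hopfian: \<open>t \<mapsto> t\<close>, \<open>a \<mapsto> a\<^sup>2\<close>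
  is a surjective endomorphism killing the commutator of $t a t^{-1}$ and \<open>a\<close>, which is nontrivial
  in \<open>B\<close> but dies in every finite quotient, because there \<open>a\<close> must have odd order.  With $x_1 = t$ and
  $x_2 = a t$ the relation becomes $x_2 = a^{-2} x_1 a^2$, where $a = x_2 x_1^{-1}$, so \<open>B\<close> is an
  irreducible C-group.  Adding a generator $x_3$ and the relations
  $x_i = (x_1 x_2 x_3)^{-1} x_i (x_1 x_2 x_3)$ gives the Hurwitz C-group $B \times \mathbb{Z}$, where
  $x_1 x_2 x_3$ generates the factor $\mathbb{Z}$; its projective quotients are $B \times \mathbb{Z}/k$,
  and the endomorphism extends to all of them by the identity on the second factor.\<close>

section \<open>Homomorphisms out of presented groups\<close>

lemma FactGroup_lift:
  assumes "group H" "f \<in> hom G H" "N \<lhd> G" "\<And>n. n \<in> N \<Longrightarrow> f n = \<one>\<^bsub>H\<^esub>"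
  obtains g where "g \<in> hom (G Mod N) H" "\<And>x. x \<in> carrier G \<Longrightarrow> g (N #>\<^bsub>G\<^esub> x) = f x"
proof -
  interpret N: normal N G by (rule assms)
  interpret group_hom G H f
    using assms N.is_group by (simp add: group_hom_def group_hom_axioms_def)
  have "N \<subseteq> kernel G H f"
    using assms(4) N.subset by (auto simp: kernel_def)
  then show ?thesis
    using FactGroup_universal_kernel[OF assms(3)] that by blast
qed

text \<open>The kernel is a subgroup, and it contains every conjugate of an element of
  \<open>R\<close> that the homomorphism kills.\<close>

lemma (in group_hom) normal_closure_trivial:
  assumes "R \<subseteq> carrier G" "\<And>r. r \<in> R \<Longrightarrow> h r = \<one>\<^bsub>H\<^esub>" "n \<in> normal_closure G R"
  shows "h n = \<one>\<^bsub>H\<^esub>"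
proof -
  have "normal_closure G R \<subseteq> kernel G H h"
    unfolding normal_closure_def
  proof (rule G.generate_subgroup_incl[OF _ subgroup_kernel], clarify)
    fix g r assume "g \<in> carrier G" "r \<in> R"
    with assms(1,2) show "g \<otimes> r \<otimes> inv g \<in> kernel G H h"
      by (auto simp: kernel_def subset_iff)
  qed
  with assms(3) show ?thesis by (auto simp: kernel_def)
qed

lemma (in group) in_normal_closure:
  assumes "R \<subseteq> carrier G" "r \<in> R"
  shows "r \<in> normal_closure G R"
proof -
  have "r = \<one> \<otimes> r \<otimes> inv \<one>" using assms by (auto simp: subset_iff)
  then show ?thesis
    unfolding normal_closure_def using assms by (intro generate.incl) blast
qed

lemma hom_eq_on_generate:
  assumes "group G" "group H" "f \<in> hom G H" "g \<in> hom G H" "S \<subseteq> carrier G"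
    and "\<And>x. x \<in> S \<Longrightarrow> f x = g x" "y \<in> generate G S"
  shows "f y = g y"
proof -
  interpret f: group_hom G H f
    using assms by (simp add: group_hom_def group_hom_axioms_def)
  interpret g: group_hom G H g
    using assms by (simp add: group_hom_def group_hom_axioms_def)
  show ?thesis using assms(7)
  proof (induction rule: generate.induct)
    case (eng y z)
    moreover have "y \<in> carrier G" "z \<in> carrier G"
      using eng.hyps f.G.generate_in_carrier[OF assms(5)] by auto
    ultimately show ?case by simp
  qed (use assms(5,6) in \<open>auto simp: subset_iff\<close>)
qed

section \<open>Evaluation of words and the universal property of the free group\<close>

fun word_eval :: "('g, 'b) monoid_scheme \<Rightarrow> ('a \<Rightarrow> 'g) \<Rightarrow> ('a \<times> bool) list \<Rightarrow> 'g" where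
  "word_eval H b [] = \<one>\<^bsub>H\<^esub>"
| "word_eval H b ((x, e) # u) = (if e then inv\<^bsub>H\<^esub> (b x) else b x) \<otimes>\<^bsub>H\<^esub> word_eval H b u"

context group
begin

lemma word_eval_closed:
  "b \<in> S \<rightarrow> carrier G \<Longrightarrow> u \<in> lists (S \<times> UNIV) \<Longrightarrow> word_eval G b u \<in> carrier G"
  by (induction u) (auto simp: Pi_iff)

lemma word_eval_append:
  "b \<in> S \<rightarrow> carrier G \<Longrightarrow> u \<in> lists (S \<times> UNIV) \<Longrightarrow> v \<in> lists (S \<times> UNIV) \<Longrightarrow>
     word_eval G b (u @ v) = word_eval G b u \<otimes> word_eval G b v"
proof (induction u)
  case (Cons l u)
  then show ?case
    by (cases l) (auto simp: m_assoc word_eval_closed[of b S] Pi_iff)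
qed (simp add: word_eval_closed[of b S])

lemma word_eval_cancel_step:
  assumes "b \<in> S \<rightarrow> carrier G" "cancel_step S u v"
  shows "word_eval G b u = word_eval G b v"
  using assms(2)
proof cases
  case (1 p q x e)
  then have b: "b x \<in> carrier G" using assms(1) by auto
  have "word_eval G b [(x, e), (x, \<not> e)] = \<one>" using b by simp
  then show ?thesis
    using 1 b word_eval_closed[OF assms(1)]
    by (simp add: word_eval_append[OF assms(1)] del: word_eval.simps append_Cons)
qed

text \<open>Deleting an adjacent pair of inverse letters leaves the value unchanged, so the value is
  constant along the generated equivalence. This makes evaluation well defined on classes.\<close>

lemma word_eval_free_rel:
  assumes "b \<in> S \<rightarrow> carrier G" "(u, v) \<in> free_rel S"
  shows "word_eval G b u = word_eval G b v"
proof -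
  have "equivclp (cancel_step S) u v" using assms(2) by (simp add: free_rel_def)
  then show ?thesis
    by (induction rule: equivclp_induct) (auto dest: word_eval_cancel_step[OF assms(1)])
qed

lemma free_group_lift:
  assumes "b \<in> S \<rightarrow> carrier G"
  obtains f where "f \<in> hom (free_group S) G" "\<And>x. x \<in> S \<Longrightarrow> f (free_gen S x) = b x"
proof
  \<comment> \<open>A class is evaluated at an arbitrarily chosen representative;
    \<open>word_eval_free_rel\<close> makes the choice irrelevant.\<close>
  let ?f = "\<lambda>A. word_eval G b (SOME u. u \<in> A)"
  have f: "?f (free_rel S `` {u}) = word_eval G b u" if "u \<in> lists (S \<times> UNIV)" for u
  proof -
    have "u \<in> free_rel S `` {u}" using equiv_class_self[OF equiv_free_rel that] .
    then have "(SOME v. v \<in> free_rel S `` {u}) \<in> free_rel S `` {u}" by (rule someI)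
    then show ?thesis using word_eval_free_rel[OF assms] by simp
  qed
  show "?f (free_gen S x) = b x" if "x \<in> S" for x
  proof -
    have "b x \<in> carrier G" using that assms by auto
    then show ?thesis unfolding free_gen_def using that by (subst f) auto
  qed
  have carr: "carrier (free_group S) = (\<lambda>u. free_rel S `` {u}) ` lists (S \<times> UNIV)"
    by (auto simp: free_group_def quotient_def)
  show "?f \<in> hom (free_group S) G"
  proof (rule homI)
    fix A assume "A \<in> carrier (free_group S)"
    then obtain u where u: "u \<in> lists (S \<times> UNIV)" "A = free_rel S `` {u}"
      unfolding carr by blast
    then show "?f A \<in> carrier G" using f word_eval_closed[OF assms] by simp
    fix B assume "B \<in> carrier (free_group S)"
    then obtain v where v: "v \<in> lists (S \<times> UNIV)" "B = free_rel S `` {v}"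
      unfolding carr by blast
    have "u @ v \<in> lists (S \<times> UNIV)" using u v by simp
    then show "?f (A \<otimes>\<^bsub>free_group S\<^esub> B) = ?f A \<otimes> ?f B"
      using u v f word_eval_append[OF assms] by (simp only: free_group_mult_class)
  qed
qed

end

lemma inv_free_gen:
  assumes "x \<in> S"
  shows "inv\<^bsub>free_group S\<^esub> (free_gen S x) = free_rel S `` {[(x, True)]}"
proof -
  interpret F: group "free_group S" by (rule group_free_group)
  have "cancel_step S ([] @ [(x, True), (x, \<not> True)] @ []) ([] @ [])"
    by (rule cancel_step.intros) (use assms in auto)
  then have "([(x, True), (x, False)], []) \<in> free_rel S"
    using assms by (auto simp: free_rel_def r_into_equivclp)
  then have "free_rel S `` {[(x, True)]} \<otimes>\<^bsub>free_group S\<^esub> free_gen S x = \<one>\<^bsub>free_group S\<^esub>"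
    unfolding free_gen_def using assms equiv_class_eq[OF equiv_free_rel]
    by (subst free_group_mult_class) (auto simp: free_group_def)
  moreover have "free_rel S `` {[(x, True)]} \<in> carrier (free_group S)"
    using assms by (auto simp: free_group_def intro: quotientI)
  ultimately show ?thesis
    using free_gen_carrier[OF assms] by (intro F.inv_equality) auto
qed

text \<open>Induction on words, splitting off the first letter. Its class is a generator or, by
  \<open>inv_free_gen\<close>, the inverse of one.\<close>

lemma generate_free_gen: "generate (free_group S) (free_gen S ` S) = carrier (free_group S)"
proof
  interpret F: group "free_group S" by (rule group_free_group)
  show "generate (free_group S) (free_gen S ` S) \<subseteq> carrier (free_group S)"
    by (rule F.generate_incl) (auto intro: free_gen_carrier)
  have "free_rel S `` {u} \<in> generate (free_group S) (free_gen S ` S)"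
    if "u \<in> lists (S \<times> UNIV)" for u
    using that
  proof (induction rule: lists.induct)
    case Nil
    then show ?case
      using generate.one[of "free_group S"] by (simp add: free_group_def)
  next
    case (Cons l u)
    obtain x e where l: "l = (x, e)" by (cases l)
    have x: "x \<in> S" using Cons.hyps l by auto
    have "free_gen S x \<in> free_gen S ` S" using x by simp
    from generate.incl[OF this, of "free_group S"] generate.inv[OF this, of "free_group S"]
    have "free_rel S `` {[l]} \<in> generate (free_group S) (free_gen S ` S)"
      unfolding inv_free_gen[OF x] by (cases e) (simp_all only: l free_gen_def[of S x])
    moreover have "free_rel S `` {l # u} =
        free_rel S `` {[l]} \<otimes>\<^bsub>free_group S\<^esub> free_rel S `` {u}"
      using Cons.hyps by (subst free_group_mult_class) auto
    ultimately show ?case using Cons.IH by (simp add: generate.eng)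
  qed
  then show "carrier (free_group S) \<subseteq> generate (free_group S) (free_gen S ` S)"
    by (auto simp: free_group_def quotient_def)
qed

section \<open>C-groups as quotients of free groups: their relations and the homomorphisms they
  admit\<close>

lemma C_proj_hom:
  assumes "C_presentation m h w"
  shows "(\<lambda>u. normal_closure (FG m) (C_relators m h w) #>\<^bsub>FG m\<^esub> u) \<in> hom (FG m) (C_group m h w)"
  unfolding C_group_def
  by (intro normal.r_coset_hom_Mod group.normal_closure_normal group_free_group
      C_relators_carrier assms)

text \<open>Translates between the relator encoding and the conjugation relation. It is used both
  for the projection onto a C-group and for homomorphisms that are to factor through it.\<close>

lemma (in group_hom) C_relator_trivial_iff:
  assumes "x \<in> carrier G" "y \<in> carrier G" "u \<in> carrier G"
  shows "h (inv x \<otimes> (inv u \<otimes> y \<otimes> u)) = \<one>\<^bsub>H\<^esub> \<longleftrightarrow>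
    h x = inv\<^bsub>H\<^esub> (h u) \<otimes>\<^bsub>H\<^esub> h y \<otimes>\<^bsub>H\<^esub> h u"
proof -
  have "h (inv x \<otimes> (inv u \<otimes> y \<otimes> u)) =
      inv\<^bsub>H\<^esub> (h x) \<otimes>\<^bsub>H\<^esub> (inv\<^bsub>H\<^esub> (h u) \<otimes>\<^bsub>H\<^esub> h y \<otimes>\<^bsub>H\<^esub> h u)"
    using assms by simp
  then show ?thesis
    using assms H.inv_solve_left'[of "\<one>\<^bsub>H\<^esub>" "h x" "inv\<^bsub>H\<^esub> (h u) \<otimes>\<^bsub>H\<^esub> h y \<otimes>\<^bsub>H\<^esub> h u"] by auto
qed

lemma C_index_carrier:
  assumes "C_presentation m h w" "(i, j, k) \<in> C_index m h"
  shows "free_gen {1..m} i \<in> carrier (FG m)" "free_gen {1..m} j \<in> carrier (FG m)"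
    "w i j k \<in> carrier (FG m)"
  using assms unfolding C_presentation_def C_index_def by (auto intro!: free_gen_carrier)

text \<open>The relator lies in the normal closure, so its coset is trivial;
  \<open>C_relator_trivial_iff\<close> turns this into the relation.\<close>

lemma C_group_relation:
  assumes P: "C_presentation m h w" and ijk: "(i, j, k) \<in> C_index m h"
  defines "p \<equiv> \<lambda>u. normal_closure (FG m) (C_relators m h w) #>\<^bsub>FG m\<^esub> u"
  shows "C_gen m h w i = inv\<^bsub>C_group m h w\<^esub> (p (w i j k)) \<otimes>\<^bsub>C_group m h w\<^esub>
    C_gen m h w j \<otimes>\<^bsub>C_group m h w\<^esub> p (w i j k)"
proof -
  interpret group_hom "FG m" "C_group m h w" p
    using C_proj_hom[OF P] group_free_group group_C_group[OF P]
    by (simp add: group_hom_def group_hom_axioms_def p_def)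
  define r where "r = inv\<^bsub>FG m\<^esub> (free_gen {1..m} i) \<otimes>\<^bsub>FG m\<^esub>
        (inv\<^bsub>FG m\<^esub> (w i j k) \<otimes>\<^bsub>FG m\<^esub> free_gen {1..m} j \<otimes>\<^bsub>FG m\<^esub> w i j k)"
  have "r \<in> C_relators m h w"
    unfolding C_relators_def r_def using ijk by force
  then have r: "r \<in> normal_closure (FG m) (C_relators m h w)"
    by (intro G.in_normal_closure C_relators_carrier[OF P])
  have "subgroup (normal_closure (FG m) (C_relators m h w)) (FG m)"
    by (intro normal_imp_subgroup G.normal_closure_normal C_relators_carrier[OF P])
  from subgroup.rcos_const[OF this G.is_group r]
  have "p r = \<one>\<^bsub>C_group m h w\<^esub>"
    unfolding p_def C_group_def by simp
  then show ?thesis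
    unfolding r_def C_relator_trivial_iff[OF C_index_carrier[OF P ijk]]
    by (simp add: p_def C_gen_def)
qed

text \<open>Von Dyck's argument: \<open>f\<close> kills the relators, hence their normal closure,
  and so factors through the quotient.\<close>

lemma C_group_lift:
  assumes P: "C_presentation m h w" and H: "group H" and f: "f \<in> hom (FG m) H"
    and rel: "\<And>i j k. (i, j, k) \<in> C_index m h \<Longrightarrow> f (free_gen {1..m} i) =
      inv\<^bsub>H\<^esub> (f (w i j k)) \<otimes>\<^bsub>H\<^esub> f (free_gen {1..m} j) \<otimes>\<^bsub>H\<^esub> f (w i j k)"
  obtains g where "g \<in> hom (C_group m h w) H"
    "\<And>i. i \<in> {1..m} \<Longrightarrow> g (C_gen m h w i) = f (free_gen {1..m} i)"
proof -
  interpret group_hom "FG m" H f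
    using f group_free_group H by (simp add: group_hom_def group_hom_axioms_def)
  have "f n = \<one>\<^bsub>H\<^esub>" if "n \<in> normal_closure (FG m) (C_relators m h w)" for n
  proof (rule normal_closure_trivial[OF C_relators_carrier[OF P] _ that])
    fix r assume "r \<in> C_relators m h w"
    then obtain i j k where ijk: "(i, j, k) \<in> C_index m h" and
      r: "r = inv\<^bsub>FG m\<^esub> (free_gen {1..m} i) \<otimes>\<^bsub>FG m\<^esub>
        (inv\<^bsub>FG m\<^esub> (w i j k) \<otimes>\<^bsub>FG m\<^esub> free_gen {1..m} j \<otimes>\<^bsub>FG m\<^esub> w i j k)"
      unfolding C_relators_def by auto
    show "f r = \<one>\<^bsub>H\<^esub>"
      unfolding r C_relator_trivial_iff[OF C_index_carrier[OF P ijk]] by (rule rel[OF ijk])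
  qed
  then obtain g where "g \<in> hom (C_group m h w) H"
    "\<And>u. u \<in> carrier (FG m) \<Longrightarrow> g (normal_closure (FG m) (C_relators m h w) #>\<^bsub>FG m\<^esub> u) = f u"
    unfolding C_group_def
    using FactGroup_lift[OF H f G.normal_closure_normal[OF C_relators_carrier[OF P]]] by blast
  with that show ?thesis by (simp add: C_gen_def free_gen_carrier)
qed

lemma generate_FactGroup:
  assumes "N \<lhd> G" "S \<subseteq> carrier G" "generate G S = carrier G"
  shows "generate (G Mod N) ((\<lambda>x. N #>\<^bsub>G\<^esub> x) ` S) = carrier (G Mod N)"
proof -
  interpret N: normal N G by (rule assms)
  interpret group_hom G "G Mod N" "\<lambda>x. N #>\<^bsub>G\<^esub> x"
    using N.r_coset_hom_Mod N.factorgroup_is_group N.is_group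
    by (simp add: group_hom_def group_hom_axioms_def)
  show ?thesis
    using generate_img[OF assms(2)] assms(3) by (simp add: carrier_FactGroup)
qed

lemma generate_C_gen:
  assumes "C_presentation m h w"
  shows "generate (C_group m h w) (C_gen m h w ` {1..m}) = carrier (C_group m h w)"
proof -
  have "C_gen m h w ` {1..m} =
      (\<lambda>u. normal_closure (FG m) (C_relators m h w) #>\<^bsub>FG m\<^esub> u) ` free_gen {1..m} ` {1..m}"
    by (simp add: C_gen_def image_image)
  then show ?thesis
    unfolding C_group_def
    using generate_FactGroup[OF group.normal_closure_normal[OF group_free_group
        C_relators_carrier[OF assms]] _ generate_free_gen]
    by (auto simp: free_gen_carrier image_subset_iff)
qed

section \<open>Quotients of Baumslag-Solitar type\<close>

text \<open>The relation gives t a^(2k) = a^(3k) t. If \<open>a\<close> had even order 2k, then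
  a^(3k) = 1 and 2k would divide 3k, which is impossible for k > 0. So the order is odd, and t a
  t^-1 is a power of \<open>a\<close>.\<close>

lemma (in group) finite_BS_commute:
  assumes fin: "finite (carrier G)" and [simp]: "a \<in> carrier G" "t \<in> carrier G"
    and rel: "a \<otimes> a \<otimes> a \<otimes> t = t \<otimes> a \<otimes> a"
  shows "t \<otimes> a \<otimes> inv t \<otimes> a = a \<otimes> (t \<otimes> a \<otimes> inv t)"
proof -
  have pow: "t \<otimes> a [^] (2 * k) = a [^] (3 * k) \<otimes> t" for k :: nat
  proof (induction k)
    case (Suc k)
    have "t \<otimes> a [^] (2 * Suc k) = (t \<otimes> a [^] (2 * k)) \<otimes> a \<otimes> a"
      by (simp add: m_assoc)
    also have "\<dots> = a [^] (3 * k) \<otimes> (t \<otimes> a \<otimes> a)" by (simp add: Suc.IH m_assoc)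
    also have "\<dots> = a [^] (3 * k) \<otimes> (a \<otimes> a \<otimes> a \<otimes> t)" by (simp only: rel)
    also have "\<dots> = a [^] (3 * Suc k) \<otimes> t"
      by (simp add: m_assoc numeral_3_eq_3)
    finally show ?case .
  qed simp
  have pos: "ord a \<ge> 1" using ord_ge_1[OF fin] by simp
  have "odd (ord a)"
  proof
    assume "even (ord a)"
    then obtain k where k: "ord a = 2 * k" by blast
    have "a [^] (3 * k) \<otimes> t = t" using pow[of k] by (simp flip: k)
    then have "a [^] (3 * k) = \<one>" using r_cancel_one' by (metis assms(2,3) nat_pow_closed)
    then have "2 * k dvd 3 * k" by (simp add: pow_eq_id k)
    with pos k show False by simp
  qed
  then obtain k where k: "ord a = 2 * k + 1" by (rule oddE)
  \<comment> \<open>An odd order makes \<open>a\<close> an even power of itself, so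
    \<open>pow\<close> applies to \<open>a\<close>.\<close>
  have "a = a [^] (2 * (k + 1))"
    using pow_ord_eq_1[of a] k by (simp add: nat_pow_mult[symmetric])
  then have "t \<otimes> a = a [^] (3 * (k + 1)) \<otimes> t" by (metis pow)
  then have "t \<otimes> a \<otimes> inv t = a [^] (3 * (k + 1))" by (simp add: m_assoc)
  then show ?thesis by (metis assms(2) nat_pow_comm nat_pow_eone)
qed

text \<open>The commutator of t a t^-1 and \<open>a\<close> is nontrivial by \<open>nc\<close>, but
  \<open>finite_BS_commute\<close> kills it in every finite quotient.\<close>

lemma (in group) BS_not_residually_finite:
  assumes [simp]: "a \<in> carrier G" "t \<in> carrier G"
    and rel: "a \<otimes> a \<otimes> a \<otimes> t = t \<otimes> a \<otimes> a"
    and nc: "t \<otimes> a \<otimes> inv t \<otimes> a \<noteq> a \<otimes> (t \<otimes> a \<otimes> inv t)"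
  shows "\<not> residually_finite G"
proof
  assume rf: "residually_finite G"
  define g where "g = t \<otimes> a \<otimes> inv t \<otimes> a \<otimes> inv (a \<otimes> (t \<otimes> a \<otimes> inv t))"
  have g: "g \<in> carrier G" by (simp add: g_def)
  have "g \<noteq> \<one>"
    using nc unfolding g_def by (metis assms(1,2) inv_closed inv_equality inv_inv m_closed)
  then obtain N where N: "N \<lhd> G" "finite (carrier (G Mod N))" "g \<notin> N"
    using rf g unfolding residually_finite_def by blast
  interpret N: normal N G by (rule N)
  interpret h: group_hom G "G Mod N" "\<lambda>x. N #> x"
    using N.r_coset_hom_Mod N.factorgroup_is_group is_group
    by (simp add: group_hom_def group_hom_axioms_def)
  have "N #> (a \<otimes> a \<otimes> a \<otimes> t) = N #> (t \<otimes> a \<otimes> a)" by (simp only: rel)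
  then have "N #> (t \<otimes> a \<otimes> inv t \<otimes> a) = N #> (a \<otimes> (t \<otimes> a \<otimes> inv t))"
    using h.H.finite_BS_commute[OF N(2), of "N #> a" "N #> t"]
    by (simp del: mult_FactGroup one_FactGroup)
  then have "N #> g = N"
    unfolding g_def by (simp del: mult_FactGroup)
  then show False using N(3) g rcos_self[OF g N.subgroup_axioms] by simp
qed

text \<open>The endomorphism \<open>f\<close> is onto but not injective. The set \<open>C\<close>
  holds further generators fixed by \<open>f\<close>: it is empty for the irreducible group and a
  central element for the Hurwitz group.\<close>

lemma (in group) BS_not_Hopfian:
  assumes [simp]: "a \<in> carrier G" "t \<in> carrier G" and C: "C \<subseteq> carrier G"
    and gen: "generate G ({a, t} \<union> C) = carrier G"
    and rel: "a \<otimes> a \<otimes> a \<otimes> t = t \<otimes> a \<otimes> a"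
    and nc: "t \<otimes> a \<otimes> inv t \<otimes> a \<noteq> a \<otimes> (t \<otimes> a \<otimes> inv t)"
    and f: "f \<in> hom G G" "f t = t" "f a = a \<otimes> a" "\<And>c. c \<in> C \<Longrightarrow> f c = c"
  shows "\<not> Hopfian G"
proof
  assume H: "Hopfian G"
  interpret f: group_hom G G f
    using f(1) by unfold_locales
  have img: "subgroup (f ` carrier G) G" by (rule f.img_is_subgroup)
  have t: "t \<in> f ` carrier G" using f(2) by (metis assms(2) imageI)
  have a2: "a \<otimes> a \<in> f ` carrier G" using f(3) by (metis assms(1) imageI)
  have conj: "t \<otimes> a \<otimes> a \<otimes> inv t = a \<otimes> a \<otimes> a"
    using rel[symmetric] by (simp add: m_assoc)
  \<comment> \<open>Surjectivity at \<open>a\<close>: write a = a^3 a^-2 with a^3 = t a^2 t^-1,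
    where \<open>t\<close> and a^2 are already known to be in the image.\<close>
  have "a = a \<otimes> (a \<otimes> a) \<otimes> inv (a \<otimes> a)"
    by (simp only: m_assoc r_inv m_closed assms(1) inv_closed r_one)
  also have "\<dots> = a \<otimes> a \<otimes> a \<otimes> inv (a \<otimes> a)"
    by (simp only: m_assoc m_closed assms(1) inv_closed)
  also have "\<dots> = t \<otimes> (a \<otimes> a) \<otimes> inv t \<otimes> inv (a \<otimes> a)"
    using conj by (simp only: m_assoc m_closed assms(1,2) inv_closed)
  also have "\<dots> \<in> f ` carrier G"
    using subgroup.m_closed[OF img subgroup.m_closed[OF img subgroup.m_closed[OF img t a2]
        subgroup.m_inv_closed[OF img t]] subgroup.m_inv_closed[OF img a2]] .
  finally have a: "a \<in> f ` carrier G" .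
  have "C \<subseteq> f ` carrier G"
  proof
    fix c assume "c \<in> C"
    then have "f c = c" "c \<in> carrier G" using f(4) C by auto
    then show "c \<in> f ` carrier G" by (metis imageI)
  qed
  with a t have "{a, t} \<union> C \<subseteq> f ` carrier G" by simp
  then have "carrier G \<subseteq> f ` carrier G"
    using generate_subgroup_incl[OF _ img] gen by blast
  then have "f \<in> epi G G" using f(1) by (simp add: epi_iff_subset)
  then have inj: "inj_on f (carrier G)"
    using H by (auto simp: Hopfian_def iso_def bij_betw_def)
  \<comment> \<open>The image of t a t^-1 is t a^2 t^-1 = a^3, which commutes with f a = a^2.
    Injectivity would carry this back and contradict \<open>nc\<close>.\<close>
  have "f (t \<otimes> a \<otimes> inv t) = a \<otimes> a \<otimes> a"
    using conj by (simp add: f m_assoc)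
  then have "f (t \<otimes> a \<otimes> inv t \<otimes> a) = f (a \<otimes> (t \<otimes> a \<otimes> inv t))"
    using f.hom_mult[of "t \<otimes> a \<otimes> inv t" a] f.hom_mult[of a "t \<otimes> a \<otimes> inv t"]
    by (simp add: f(3) m_assoc del: f.hom_mult)
  then show False using nc inj_onD[OF inj] by simp
qed

text \<open>Noncommutation is witnessed by a homomorphism \<rho> into another group \<open>H\<close>
  instead of being stated in \<open>G\<close>. In this form it passes to any quotient through which
  \<rho> factors.\<close>

locale BS_group = group G + H: group H for G (structure) and H +
  fixes a t C f \<rho>
  assumes a [simp]: "a \<in> carrier G" and t [simp]: "t \<in> carrier G" and C: "C \<subseteq> carrier G"
    and gen: "generate G ({a, t} \<union> C) = carrier G"
    and rel: "a \<otimes> a \<otimes> a \<otimes> t = t \<otimes> a \<otimes> a"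
    and f: "f \<in> hom G G" "f t = t" "f a = a \<otimes> a" "\<And>c. c \<in> C \<Longrightarrow> f c = c"
    and \<rho>: "\<rho> \<in> hom G H"
    and nc: "\<rho> t \<otimes>\<^bsub>H\<^esub> \<rho> a \<otimes>\<^bsub>H\<^esub> inv\<^bsub>H\<^esub> \<rho> t \<otimes>\<^bsub>H\<^esub> \<rho> a \<noteq>
      \<rho> a \<otimes>\<^bsub>H\<^esub> (\<rho> t \<otimes>\<^bsub>H\<^esub> \<rho> a \<otimes>\<^bsub>H\<^esub> inv\<^bsub>H\<^esub> \<rho> t)"
begin

sublocale \<rho>: group_hom G H \<rho>
  using \<rho> by unfold_locales

sublocale f: group_hom G G f
  using f(1) by unfold_locales

lemma not_commute: "t \<otimes> a \<otimes> inv t \<otimes> a \<noteq> a \<otimes> (t \<otimes> a \<otimes> inv t)"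
proof
  assume "t \<otimes> a \<otimes> inv t \<otimes> a = a \<otimes> (t \<otimes> a \<otimes> inv t)"
  then have "\<rho> (t \<otimes> a \<otimes> inv t \<otimes> a) = \<rho> (a \<otimes> (t \<otimes> a \<otimes> inv t))" by simp
  with nc show False by simp
qed

lemma not_Hopfian_not_residually_finite: "\<not> Hopfian G" "\<not> residually_finite G"
  using BS_not_Hopfian[OF a t C gen rel not_commute f] BS_not_residually_finite[OF a t rel not_commute]
  by auto

text \<open>Since \<open>f\<close> fixes \<open>r\<close> and \<rho> kills it, both maps descend to
  the quotient, which is therefore again an instance of \<open>BS_group\<close>. For
  \<open>r\<close> a power of the central product this covers the projective Hurwitz groups.\<close>

lemma quotient_not_Hopfian_not_residually_finite:
  assumes r: "r \<in> carrier G" "f r = r" "\<rho> r = \<one>\<^bsub>H\<^esub>"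
  defines "Q \<equiv> G Mod normal_closure G {r}"
  shows "\<not> Hopfian Q" "\<not> residually_finite Q"
proof -
  define N where "N = normal_closure G {r}"
  have N: "N \<lhd> G" unfolding N_def using r by (intro normal_closure_normal) simp
  interpret N: normal N G by (rule N)
  have Q: "group Q" unfolding Q_def N_def[symmetric] by (rule N.factorgroup_is_group)
  let ?p = "\<lambda>x. N #> x"
  have p: "?p \<in> hom G Q" unfolding Q_def N_def[symmetric] by (rule N.r_coset_hom_Mod)
  interpret p: group_hom G Q ?p
    using p Q is_group by (simp add: group_hom_def group_hom_axioms_def)
  interpret pf: group_hom G Q "?p \<circ> f"
    using Group.hom_compose[OF f(1) p] Q is_group by (simp add: group_hom_def group_hom_axioms_def)
  have "r \<in> N" unfolding N_def using r by (intro in_normal_closure) auto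
  then have pr: "?p r = \<one>\<^bsub>Q\<^esub>" using N.rcos_const[OF is_group] by (simp add: Q_def N_def)
  have "(?p \<circ> f) n = \<one>\<^bsub>Q\<^esub>" if "n \<in> N" for n
    using pf.normal_closure_trivial[of "{r}" n] that r pr by (auto simp: N_def)
  then obtain f' where f': "f' \<in> hom Q Q" "\<And>x. x \<in> carrier G \<Longrightarrow> f' (?p x) = (?p \<circ> f) x"
    using FactGroup_lift[OF Q pf.homh N] unfolding Q_def N_def[symmetric] by blast
  have "\<rho> n = \<one>\<^bsub>H\<^esub>" if "n \<in> N" for n
    using \<rho>.normal_closure_trivial[of "{r}" n] that r by (auto simp: N_def)
  then obtain \<rho>' where \<rho>': "\<rho>' \<in> hom Q H" "\<And>x. x \<in> carrier G \<Longrightarrow> \<rho>' (?p x) = \<rho> x"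
    using FactGroup_lift[OF H.is_group \<rho> N] unfolding Q_def N_def[symmetric] by blast
  interpret Q: BS_group Q H "?p a" "?p t" "?p ` C" f' \<rho>'
  proof (intro BS_group.intro BS_group_axioms.intro Q H.is_group)
    have "generate Q (?p ` ({a, t} \<union> C)) = carrier Q"
      unfolding Q_def N_def[symmetric] by (rule generate_FactGroup[OF N _ gen]) (use C in auto)
    then show "generate Q ({?p a, ?p t} \<union> ?p ` C) = carrier Q" by simp
    have "?p (a \<otimes> a \<otimes> a \<otimes> t) = ?p (t \<otimes> a \<otimes> a)" by (simp only: rel)
    then show "?p a \<otimes>\<^bsub>Q\<^esub> ?p a \<otimes>\<^bsub>Q\<^esub> ?p a \<otimes>\<^bsub>Q\<^esub> ?p t = ?p t \<otimes>\<^bsub>Q\<^esub> ?p a \<otimes>\<^bsub>Q\<^esub> ?p a" by simp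
    show "?p ` C \<subseteq> carrier Q" using C by (auto simp: subset_iff)
  next
    fix c assume "c \<in> ?p ` C"
    then show "f' c = c" using C f' f(4) by auto
  qed (use f' \<rho>' f nc in auto)
  show "\<not> Hopfian Q" "\<not> residually_finite Q"
    by (rule Q.not_Hopfian_not_residually_finite)+
qed

end

section \<open>A permutation representation of the Baumslag-Solitar group\<close>

text \<open>On each copy of the integers the square of the translation \<open>perm_a\<close> has two orbits and its
  cube three; \<open>perm_t\<close> carries the \<open>n\<close>-th orbit of the square to the \<open>n\<close>-th orbit of the cube.\<close>

definition perm_a :: "nat \<times> int \<Rightarrow> nat \<times> int" where
  "perm_a = (\<lambda>(i, z). (i, z + 1))"

definition perm_t :: "nat \<times> int \<Rightarrow> nat \<times> int" where
  "perm_t = (\<lambda>(i, z). let n = 2 * i + nat (z mod 2) in (n div 3, 3 * (z div 2) + int (n mod 3)))"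

text \<open>Orbits of the square are numbered 2i + (z mod 2), those of the cube 3i + (z mod 3), and
  the quotient z div 2 or z div 3 is the position within the orbit. With infinitely many copies of
  the integers both numberings run through all naturals, so the orbits can be matched
  bijectively.\<close>

definition perm_t_inv :: "nat \<times> int \<Rightarrow> nat \<times> int" where
  "perm_t_inv = (\<lambda>(i, z). let n = 3 * i + nat (z mod 3) in (n div 2, 2 * (z div 3) + int (n mod 2)))"

abbreviation perms :: "(nat \<times> int \<Rightarrow> nat \<times> int) monoid" where
  "perms \<equiv> BijGroup UNIV"

lemma carrier_perms: "p \<in> carrier (BijGroup UNIV) \<longleftrightarrow> bij p"
  by (simp add: BijGroup_def Bij_def)

lemma mult_perms: "bij p \<Longrightarrow> bij q \<Longrightarrow> p \<otimes>\<^bsub>BijGroup UNIV\<^esub> q = p \<circ> q"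
  by (simp add: BijGroup_def Bij_def compose_def fun_eq_iff)

lemma one_perms: "\<one>\<^bsub>BijGroup UNIV\<^esub> = id"
  by (simp add: BijGroup_def fun_eq_iff)

lemma bij_perm_a: "bij perm_a"
  by (rule o_bij[of "\<lambda>(i, z). (i, z - 1)"]) (auto simp: perm_a_def fun_eq_iff)

text \<open>Coordinates adapted to the \<open>d\<close>-th power of \<open>perm_a\<close>:
  \<open>n\<close> numbers the orbit and \<open>q\<close> is the position in it. They are taken with
  \<open>d\<close> = 2 and \<open>d\<close> = 3, where \<open>perm_t\<close> and
  \<open>perm_t_inv\<close> only exchange the two coordinate systems.\<close>

lemma orbit_index:
  fixes p :: "nat \<times> int" and d :: nat
  assumes "d > 0"
  obtains n q where "p = (n div d, int d * q + int (n mod d))"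
proof -
  obtain i z where p: "p = (i, z)" by (cases p)
  define r where "r = nat (z mod int d)"
  have r: "r < d" "int r = z mod int d"
    using assms by (simp_all add: r_def nat_less_iff)
  then have "p = ((d * i + r) div d, int d * (z div int d) + int ((d * i + r) mod d))"
    by (simp add: p)
  then show thesis by (rule that)
qed

lemma perm_t_orbit: "perm_t (n div 2, 2 * q + int (n mod 2)) = (n div 3, 3 * q + int (n mod 3))"
proof -
  have "(2 * q + int (n mod 2)) mod 2 = int (n mod 2)" "(2 * q + int (n mod 2)) div 2 = q"
    by (simp_all add: zmod_int)
  then show ?thesis by (simp add: perm_t_def)
qed

lemma perm_t_inv_orbit:
  "perm_t_inv (n div 3, 3 * q + int (n mod 3)) = (n div 2, 2 * q + int (n mod 2))"
proof -
  have "(3 * q + int (n mod 3)) mod 3 = int (n mod 3)" "(3 * q + int (n mod 3)) div 3 = q"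
    by (simp_all add: zmod_int)
  then show ?thesis by (simp add: perm_t_inv_def)
qed

lemma perm_t_inverse: "perm_t_inv (perm_t p) = p" "perm_t (perm_t_inv p) = p"
proof -
  obtain n q where "p = (n div 2, int 2 * q + int (n mod 2))"
    by (rule orbit_index[of 2]) simp
  then show "perm_t_inv (perm_t p) = p" by (simp add: perm_t_orbit perm_t_inv_orbit)
  obtain n q where "p = (n div 3, int 3 * q + int (n mod 3))"
    by (rule orbit_index[of 3]) simp
  then show "perm_t (perm_t_inv p) = p" by (simp add: perm_t_orbit perm_t_inv_orbit)
qed

lemma bij_perm_t: "bij perm_t" "bij perm_t_inv"
  by (rule o_bij[of perm_t_inv] o_bij[of perm_t]; simp add: fun_eq_iff perm_t_inverse)+

text \<open>Two steps of \<open>perm_a\<close> keep the parity of z and raise z div 2 by one, which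
  \<open>perm_t\<close> turns into three steps.\<close>

lemma perm_rel: "perm_a (perm_a (perm_a (perm_t p))) = perm_t (perm_a (perm_a p))"
  by (cases p) (simp add: perm_a_def perm_t_def Let_def)

lemma perms_facts:
  shows "perm_a \<in> carrier perms" "perm_t \<in> carrier perms"
    "perm_a \<otimes>\<^bsub>perms\<^esub> perm_a \<otimes>\<^bsub>perms\<^esub> perm_a \<otimes>\<^bsub>perms\<^esub> perm_t =
      perm_t \<otimes>\<^bsub>perms\<^esub> perm_a \<otimes>\<^bsub>perms\<^esub> perm_a" (is ?rel)
    "perm_t \<otimes>\<^bsub>perms\<^esub> perm_a \<otimes>\<^bsub>perms\<^esub> inv\<^bsub>perms\<^esub> perm_t \<otimes>\<^bsub>perms\<^esub> perm_a \<noteq>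
      perm_a \<otimes>\<^bsub>perms\<^esub> (perm_t \<otimes>\<^bsub>perms\<^esub> perm_a \<otimes>\<^bsub>perms\<^esub> inv\<^bsub>perms\<^esub> perm_t)" (is ?nc)
proof -
  note bij = bij_perm_a bij_perm_t
  show "perm_a \<in> carrier perms" "perm_t \<in> carrier perms"
    by (simp_all add: carrier_perms bij)
  have inv: "inv\<^bsub>perms\<^esub> perm_t = perm_t_inv"
    by (rule group.inv_equality[OF group_BijGroup])
       (simp_all add: carrier_perms mult_perms one_perms bij fun_eq_iff perm_t_inverse)
  show ?rel
    by (simp add: mult_perms bij bij_comp fun_eq_iff perm_rel)
  \<comment> \<open>At (0, 0) the left side takes the value (0, 3) and the right side the value (0,
    2).\<close>
  have "(perm_t \<circ> perm_a \<circ> perm_t_inv \<circ> perm_a) (0, 0) \<noteq>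
      (perm_a \<circ> (perm_t \<circ> perm_a \<circ> perm_t_inv)) (0, 0)"
    by (simp add: perm_a_def perm_t_def perm_t_inv_def Let_def)
  then have "perm_t \<circ> perm_a \<circ> perm_t_inv \<circ> perm_a \<noteq> perm_a \<circ> (perm_t \<circ> perm_a \<circ> perm_t_inv)"
    by metis
  then show ?nc by (simp add: inv mult_perms bij bij_comp)
qed

section \<open>The abelianization\<close>

text \<open>The composite of \<phi> and \<sigma> agrees with the projection on generators, hence
  everywhere, so the kernel of \<phi> lies in the derived subgroup. The converse inclusion holds
  because \<open>H\<close> is commutative, and the first isomorphism theorem concludes.\<close>

lemma abelianization_iso:
  assumes G: "group G" and H: "comm_group H" and \<phi>: "\<phi> \<in> epi G H"
    and \<sigma>: "\<sigma> \<in> hom H (abelianization G)"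
    and S: "S \<subseteq> carrier G" "generate G S = carrier G"
    and eq: "\<And>x. x \<in> S \<Longrightarrow> \<sigma> (\<phi> x) = derived G (carrier G) #>\<^bsub>G\<^esub> x"
  shows "abelianization G \<cong> H"
proof -
  interpret G: group G by (rule G)
  interpret H: comm_group H by (rule H)
  interpret \<phi>: group_hom G H \<phi>
    using \<phi> by unfold_locales (simp add: epi_def)
  let ?D = "derived G (carrier G)"
  interpret D: normal ?D G by (rule G.derived_self_is_normal)
  have A: "group (abelianization G)"
    unfolding abelianization_def by (rule D.factorgroup_is_group)
  interpret \<sigma>: group_hom H "abelianization G" \<sigma>
    using \<sigma> A by (simp add: group_hom_def group_hom_axioms_def H.is_group)
  have p: "(\<lambda>x. ?D #>\<^bsub>G\<^esub> x) \<in> hom G (abelianization G)"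
    unfolding abelianization_def by (rule D.r_coset_hom_Mod)
  have "kernel G H \<phi> \<subseteq> ?D"
  proof
    fix x assume x: "x \<in> kernel G H \<phi>"
    then have xG: "x \<in> generate G S" by (simp add: kernel_def S(2))
    have "?D #>\<^bsub>G\<^esub> x = (\<sigma> \<circ> \<phi>) x"
      using hom_eq_on_generate[OF G A p Group.hom_compose[OF \<phi>.homh \<sigma>] S(1) _ xG] eq by simp
    also have "\<dots> = ?D" using x \<sigma>.hom_one by (simp add: kernel_def abelianization_def)
    finally show "x \<in> ?D" using x G.rcos_self[OF _ D.subgroup_axioms, of x] by (auto simp: kernel_def)
  qed
  moreover have "?D \<subseteq> kernel G H \<phi>"
    unfolding derived_def
    by (rule G.generate_subgroup_incl[OF _ \<phi>.subgroup_kernel])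
       (auto simp: kernel_def H.m_comm H.m_assoc,
        metis H.inv_closed H.m_closed H.m_comm H.r_inv H.m_assoc H.r_one \<phi>.hom_closed)
  ultimately have "kernel G H \<phi> = ?D" by blast
  then show ?thesis
    using \<phi>.FactGroup_iso \<phi> by (simp add: abelianization_def epi_def)
qed

section \<open>The two C-groups\<close>

text \<open>The conjugating word of the relation x_2 = a^-2 x_1 a^2. The number \<open>m\<close> of
  generators is a parameter because the word is used for both \<open>m\<close> = 2 and
  \<open>m\<close> = 3.\<close>

definition bs_word :: "nat \<Rightarrow> (nat \<times> bool) list set" where
  "bs_word m = (let a = free_gen {1..m} 2 \<otimes>\<^bsub>FG m\<^esub> inv\<^bsub>FG m\<^esub> free_gen {1..m} 1 in a \<otimes>\<^bsub>FG m\<^esub> a)"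

lemma bs_word_carrier:
  assumes "2 \<le> m"
  shows "bs_word m \<in> carrier (FG m)"
proof -
  interpret F: group "FG m" by (rule group_free_group)
  show ?thesis
    unfolding bs_word_def Let_def using assms
    by (intro F.m_closed F.inv_closed free_gen_carrier) auto
qed

lemma hom_bs_word:
  assumes "2 \<le> m" "group H" "f \<in> hom (FG m) H"
  shows "f (bs_word m) = f (free_gen {1..m} 2) \<otimes>\<^bsub>H\<^esub> inv\<^bsub>H\<^esub> f (free_gen {1..m} 1) \<otimes>\<^bsub>H\<^esub>
    (f (free_gen {1..m} 2) \<otimes>\<^bsub>H\<^esub> inv\<^bsub>H\<^esub> f (free_gen {1..m} 1))"
proof -
  interpret group_hom "FG m" H f
    using assms group_free_group by (simp add: group_hom_def group_hom_axioms_def)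
  have sq: "f (x \<otimes>\<^bsub>FG m\<^esub> inv\<^bsub>FG m\<^esub> y \<otimes>\<^bsub>FG m\<^esub> (x \<otimes>\<^bsub>FG m\<^esub> inv\<^bsub>FG m\<^esub> y)) =
      f x \<otimes>\<^bsub>H\<^esub> inv\<^bsub>H\<^esub> f y \<otimes>\<^bsub>H\<^esub> (f x \<otimes>\<^bsub>H\<^esub> inv\<^bsub>H\<^esub> f y)"
    if "x \<in> carrier (FG m)" "y \<in> carrier (FG m)" for x y
    using that by (simp del: One_nat_def)
  show ?thesis
    unfolding bs_word_def Let_def using assms(1) by (intro sq free_gen_carrier) auto
qed

text \<open>Substitute x = a t and multiply the conjugation relation by a^2 on the left.\<close>

lemma (in group) BS_relation_iff:
  assumes [simp]: "x \<in> carrier G" "t \<in> carrier G"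
  defines "a \<equiv> x \<otimes> inv t"
  shows "x = inv (a \<otimes> a) \<otimes> t \<otimes> (a \<otimes> a) \<longleftrightarrow> a \<otimes> a \<otimes> a \<otimes> t = t \<otimes> a \<otimes> a"
proof -
  have [simp]: "a \<in> carrier G" by (simp add: a_def)
  have x: "x = a \<otimes> t" by (simp add: a_def m_assoc)
  have "x = inv (a \<otimes> a) \<otimes> t \<otimes> (a \<otimes> a) \<longleftrightarrow> x = inv (a \<otimes> a) \<otimes> (t \<otimes> (a \<otimes> a))"
    by (simp only: m_assoc m_closed inv_closed \<open>a \<in> carrier G\<close> assms(2))
  also have "\<dots> \<longleftrightarrow> t \<otimes> (a \<otimes> a) = a \<otimes> a \<otimes> x"
    by (rule inv_solve_left) auto
  also have "\<dots> \<longleftrightarrow> a \<otimes> a \<otimes> a \<otimes> t = t \<otimes> a \<otimes> a"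
    unfolding x by (auto simp: m_assoc)
  finally show ?thesis .
qed

text \<open>Applying the relation twice gives a^6 t = a^3 t a^2 = t a^4. This is what makes a ->
  a^2, t -> t an endomorphism.\<close>

lemma (in group) BS_relation_square:
  assumes [simp]: "a \<in> carrier G" "t \<in> carrier G" and rel: "a \<otimes> a \<otimes> a \<otimes> t = t \<otimes> a \<otimes> a"
  defines "b \<equiv> a \<otimes> a"
  shows "b \<otimes> b \<otimes> b \<otimes> t = t \<otimes> b \<otimes> b"
proof -
  have "b \<otimes> b \<otimes> b \<otimes> t = a \<otimes> a \<otimes> a \<otimes> (a \<otimes> a \<otimes> a \<otimes> t)" by (simp add: b_def m_assoc)
  also have "\<dots> = a \<otimes> a \<otimes> a \<otimes> (t \<otimes> a \<otimes> a)" by (simp only: rel)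
  also have "\<dots> = a \<otimes> a \<otimes> a \<otimes> t \<otimes> (a \<otimes> a)" by (simp add: m_assoc)
  also have "\<dots> = t \<otimes> a \<otimes> a \<otimes> (a \<otimes> a)" by (simp only: rel)
  also have "\<dots> = t \<otimes> b \<otimes> b" by (simp add: b_def m_assoc)
  finally show ?thesis .
qed

lemma (in group) generate_conv:
  assumes "S \<subseteq> carrier G" "T \<subseteq> carrier G" "generate G S = carrier G" "S \<subseteq> generate G T"
  shows "generate G T = carrier G"
  using generate_subgroup_incl[OF assms(4) generate_is_subgroup[OF assms(2)]] assms(3)
    generate_incl[OF assms(2)] by blast

lemma (in comm_group) conj_trivial:
  assumes "x \<in> carrier G" "u \<in> carrier G"
  shows "inv u \<otimes> x \<otimes> u = x"
  using assms by (simp add: m_comm[of "inv u" x] m_assoc)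

text \<open>The relations involve the values of the words \<open>w i j k\<close>, which are
  accessible only through a homomorphism on the free group. They are therefore checked for every
  \<open>f\<close> that extends \<open>b\<close>.\<close>

lemma C_hom_exists:
  assumes P: "C_presentation m h w" and H: "group H" and b: "b \<in> {1..m} \<rightarrow> carrier H"
    and rel: "\<And>f i j k. f \<in> hom (FG m) H \<Longrightarrow> (\<And>l. l \<in> {1..m} \<Longrightarrow> f (free_gen {1..m} l) = b l) \<Longrightarrow>
      (i, j, k) \<in> C_index m h \<Longrightarrow> b i = inv\<^bsub>H\<^esub> (f (w i j k)) \<otimes>\<^bsub>H\<^esub> b j \<otimes>\<^bsub>H\<^esub> f (w i j k)"
  obtains g where "g \<in> hom (C_group m h w) H" "\<And>i. i \<in> {1..m} \<Longrightarrow> g (C_gen m h w i) = b i"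
proof -
  obtain f where f: "f \<in> hom (FG m) H" "\<And>l. l \<in> {1..m} \<Longrightarrow> f (free_gen {1..m} l) = b l"
    using group.free_group_lift[OF H b] by blast
  have "f (free_gen {1..m} i) =
      inv\<^bsub>H\<^esub> (f (w i j k)) \<otimes>\<^bsub>H\<^esub> f (free_gen {1..m} j) \<otimes>\<^bsub>H\<^esub> f (w i j k)"
    if "(i, j, k) \<in> C_index m h" for i j k
    using rel[OF f that] f(2) that by (simp add: C_index_def)
  then obtain g where "g \<in> hom (C_group m h w) H" "\<And>i. i \<in> {1..m} \<Longrightarrow> g (C_gen m h w i) = f (free_gen {1..m} i)"
    using C_group_lift[OF P H f(1)] by blast
  with f(2) that show thesis by simp
qed

text \<open>Conjugation is trivial in a commutative target, so each relation reduces to the equality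
  of two values of \<open>b\<close>.\<close>

lemma C_hom_exists_comm:
  assumes P: "C_presentation m h w" and H: "comm_group H" and b: "b \<in> {1..m} \<rightarrow> carrier H"
    and eq: "\<And>i j k. (i, j, k) \<in> C_index m h \<Longrightarrow> b i = b j"
  obtains g where "g \<in> hom (C_group m h w) H" "\<And>i. i \<in> {1..m} \<Longrightarrow> g (C_gen m h w i) = b i"
proof (rule C_hom_exists[OF P comm_group.axioms(2)[OF H] b])
  fix f i j k
  assume f: "f \<in> hom (FG m) H" and ijk: "(i, j, k) \<in> C_index m h"
  have "f (w i j k) \<in> carrier H" "b j \<in> carrier H"
    using C_index_carrier[OF P ijk] hom_carrier[OF f] b ijk by (auto simp: C_index_def)
  then show "b i = inv\<^bsub>H\<^esub> (f (w i j k)) \<otimes>\<^bsub>H\<^esub> b j \<otimes>\<^bsub>H\<^esub> f (w i j k)"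
    using eq[OF ijk] by (simp add: comm_group.conj_trivial[OF H])
qed (use that in blast)

text \<open>The two generators are conjugate, and conjugates have the same image in a commutative
  quotient.\<close>

lemma C_gen_abelianization_eq:
  assumes P: "C_presentation m h w" and ijk: "(i, j, k) \<in> C_index m h"
  defines "G \<equiv> C_group m h w"
  shows "derived G (carrier G) #>\<^bsub>G\<^esub> C_gen m h w i = derived G (carrier G) #>\<^bsub>G\<^esub> C_gen m h w j"
proof -
  interpret G: group G unfolding G_def by (rule group_C_group[OF P])
  let ?D = "derived G (carrier G)"
  interpret D: normal ?D G by (rule G.derived_self_is_normal)
  interpret A: comm_group "G Mod ?D" by (rule G.derived_quot_is_comm_group)
  interpret p: group_hom G "G Mod ?D" "\<lambda>x. ?D #>\<^bsub>G\<^esub> x"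
    using D.r_coset_hom_Mod by (simp add: group_hom_def group_hom_axioms_def A.is_group G.is_group)
  define u where "u = normal_closure (FG m) (C_relators m h w) #>\<^bsub>FG m\<^esub> w i j k"
  have u: "u \<in> carrier G"
    unfolding G_def u_def using hom_carrier[OF C_proj_hom[OF P]] C_index_carrier[OF P ijk] by auto
  have x: "C_gen m h w j \<in> carrier G"
    unfolding G_def using ijk by (intro C_gen_carrier) (auto simp: C_index_def)
  have "C_gen m h w i = inv\<^bsub>G\<^esub> u \<otimes>\<^bsub>G\<^esub> C_gen m h w j \<otimes>\<^bsub>G\<^esub> u"
    unfolding G_def u_def by (rule C_group_relation[OF P ijk])
  then show ?thesis
    using u x A.conj_trivial[of "?D #>\<^bsub>G\<^esub> C_gen m h w j" "?D #>\<^bsub>G\<^esub> u"]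
    by (simp del: mult_FactGroup one_FactGroup)
qed

text \<open>The common part of the two examples: at least two generators and the Baumslag-Solitar
  relation at index (2, 1, 1). Any other relations are left open.\<close>

locale BS_C_group =
  fixes m h w and G (structure) and x
  defines G_def: "G \<equiv> C_group m h w" and x_def: "x \<equiv> C_gen m h w"
  assumes m2: "2 \<le> m" and P: "C_presentation m h w"
    and index: "(2, 1, 1) \<in> C_index m h" and word: "w 2 1 1 = bs_word m"
begin

sublocale group G
  unfolding G_def by (rule group_C_group[OF P])

lemma x_carrier: "i \<in> {1..m} \<Longrightarrow> x i \<in> carrier G"
  unfolding G_def x_def by (rule C_gen_carrier)

lemma BS_relation:
  defines "a \<equiv> x 2 \<otimes> inv (x 1)"
  shows "a \<otimes> a \<otimes> a \<otimes> x 1 =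
    x 1 \<otimes> a \<otimes> a"
proof -
  have x: "x 2 \<in> carrier G" "x 1 \<in> carrier G" using x_carrier m2 by auto
  have "normal_closure (FG m) (C_relators m h w) #>\<^bsub>FG m\<^esub> w 2 1 1 = a \<otimes> a"
    unfolding word a_def
    using hom_bs_word[OF m2 is_group C_proj_hom[OF P, folded G_def]] by (simp only: x_def C_gen_def)
  with C_group_relation[OF P index, folded G_def x_def]
  have "x 2 = inv (a \<otimes> a) \<otimes> x 1 \<otimes> (a \<otimes> a)" by simp
  then show ?thesis
    unfolding a_def by (rule iffD1[OF BS_relation_iff[OF x]])
qed

text \<open>Homomorphisms out of a C-group are prescribed on the C-generators, while
  \<open>BS_group\<close> speaks about \<open>a\<close>. The values at \<open>a\<close> = x_2 x_1^-1
  follow by cancelling the factor x_1, and generators beyond the second must be expressible through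
  \<open>a\<close>, \<open>x 1\<close> and \<open>C\<close>.\<close>

lemma BS_group_perms:
  assumes "f \<in> hom G G" "f (x 1) = x 1"
    "f (x 2) = a \<otimes> a \<otimes> x 1"
    "\<And>c. c \<in> C \<Longrightarrow> f c = c"
    and C: "C \<subseteq> carrier G"
    and gen: "x ` {3..m} \<subseteq> generate G ({a, x 1} \<union> C)"
    and \<rho>: "\<rho> \<in> hom G perms" "\<rho> (x 1) = perm_t" "\<rho> (x 2) = perm_a \<otimes>\<^bsub>perms\<^esub> perm_t"
    and a: "a = x 2 \<otimes> inv (x 1)"
  shows "BS_group G perms a (x 1) C f \<rho>"
proof -
  interpret f: group_hom G G f
    using assms(1) by unfold_locales
  interpret perms: group perms by (rule group_BijGroup)
  interpret \<rho>: group_hom G perms \<rho>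
    using \<rho>(1) by unfold_locales
  have X: "x 1 \<in> carrier G" "x 2 \<in> carrier G"
    using x_carrier m2 by auto
  then have a_carrier: "a \<in> carrier G" by (simp add: a)
  have fa: "f a = a \<otimes> a"
    unfolding a f.hom_mult[OF X(2) inv_closed[OF X(1)]] f.hom_inv[OF X(1)] assms(2,3)
    using X by (simp add: m_assoc)
  have \<rho>a: "\<rho> a = perm_a"
    unfolding a \<rho>.hom_mult[OF X(2) inv_closed[OF X(1)]] \<rho>.hom_inv[OF X(1)] \<rho>(2,3)
    using perms_facts(1,2) by (simp add: perms.m_assoc)
  have sub: "{a, x 1} \<union> C \<subseteq> carrier G" using X a_carrier C by simp
  have "x 1 \<in> generate G ({a, x 1} \<union> C)" "a \<in> generate G ({a, x 1} \<union> C)"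
    by (auto intro: generate.incl)
  moreover from generate.eng[OF this(2,1)] have "x 2 \<in> generate G ({a, x 1} \<union> C)"
    using X by (simp add: a m_assoc)
  moreover have "{1..m} = {1, 2} \<union> {3..m}" using m2 by auto
  ultimately have "x ` {1..m} \<subseteq> generate G ({a, x 1} \<union> C)"
    using gen by auto
  then have "generate G ({a, x 1} \<union> C) = carrier G"
    using generate_conv[OF _ sub generate_C_gen[OF P, folded G_def x_def]] x_carrier by blast
  then show ?thesis
    using a_carrier X C assms(1-4) fa BS_relation perms_facts \<rho> \<rho>a is_group perms.is_group
    by (intro BS_group.intro BS_group_axioms.intro) (simp_all add: a)
qed

end

text \<open>The elements commuting with \<open>c\<close> form a subgroup; the induction checks its
  closure properties.\<close>

lemma (in group) commute_generate:
  assumes c: "c \<in> carrier G" and S: "S \<subseteq> carrier G"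
    and comm: "\<And>s. s \<in> S \<Longrightarrow> c \<otimes> s = s \<otimes> c" and g: "g \<in> generate G S"
  shows "c \<otimes> g = g \<otimes> c"
  using g
proof (induction rule: generate.induct)
  case one
  then show ?case using c by simp
next
  case (incl s)
  then show ?case by (rule comm)
next
  case (inv s)
  then have s: "s \<in> carrier G" using S by auto
  have "s \<otimes> c \<otimes> inv s = c" using comm[OF inv] c s by (simp flip: comm[OF inv] add: m_assoc)
  then show ?case using c s by (metis inv_closed inv_solve_left m_assoc m_closed)
next
  case (eng y z)
  then have "y \<in> carrier G" "z \<in> carrier G" using generate_in_carrier[OF S] by auto
  then show ?case using eng.IH c by (metis m_assoc)
qed

text \<open>Since a t t^-1 = a, the bs word is sent to a^2, and \<open>BS_relation_iff\<close>
  applies in \<open>H\<close>.\<close>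

lemma hom_bs_word_relation:
  assumes "2 \<le> m" and H: "group H" and f: "f \<in> hom (FG m) H"
    and a: "a \<in> carrier H" and t: "t \<in> carrier H"
    and rel: "a \<otimes>\<^bsub>H\<^esub> a \<otimes>\<^bsub>H\<^esub> a \<otimes>\<^bsub>H\<^esub> t = t \<otimes>\<^bsub>H\<^esub> a \<otimes>\<^bsub>H\<^esub> a"
    and f1: "f (free_gen {1..m} 1) = t" and f2: "f (free_gen {1..m} 2) = a \<otimes>\<^bsub>H\<^esub> t"
  shows "a \<otimes>\<^bsub>H\<^esub> t = inv\<^bsub>H\<^esub> f (bs_word m) \<otimes>\<^bsub>H\<^esub> t \<otimes>\<^bsub>H\<^esub> f (bs_word m)"
proof -
  interpret H: group H by (rule H)
  have "a \<otimes>\<^bsub>H\<^esub> t \<otimes>\<^bsub>H\<^esub> inv\<^bsub>H\<^esub> t = a" using a t by (simp add: H.m_assoc)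
  then show ?thesis
    using H.BS_relation_iff[OF H.m_closed[OF a t] t] rel
    unfolding hom_bs_word[OF assms(1-3)] f1 f2 by simp
qed

lemma nat_3_cases: "i \<in> {1..3::nat} \<longleftrightarrow> i = 1 \<or> i = 2 \<or> i = 3"
  by auto

lemma nat_2_cases: "i \<in> {1..2::nat} \<longleftrightarrow> i = 1 \<or> i = 2"
  by auto

lemma irreducible_non_Hopfian:
  "\<exists>m h w. irreducible_C_presentation m h w \<and>
     \<not> Hopfian (C_group m h w) \<and> \<not> residually_finite (C_group m h w)"
proof -
  \<comment> \<open>Only (2, 1) has a positive value, so the single relation is the one at index (2,
    1, 1).\<close>
  define h :: "nat \<Rightarrow> nat \<Rightarrow> int" where "h = (\<lambda>i j. if i = 2 \<and> j = 1 then 1 else 0)"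
  define w :: "nat \<Rightarrow> nat \<Rightarrow> int \<Rightarrow> (nat \<times> bool) list set" where "w = (\<lambda>_ _ _. bs_word 2)"
  define G where "G = C_group 2 h w"
  define x where "x = C_gen 2 h w"
  have in_index_iff: "ijk \<in> C_index 2 h \<longleftrightarrow> ijk = (2, 1, 1)" for ijk
    by (auto simp: C_index_def h_def split: if_splits)
  have P: "C_presentation 2 h w"
    by (simp add: C_presentation_def w_def bs_word_carrier del: One_nat_def)
  interpret BS_C_group 2 h w G x
    by unfold_locales (simp_all add: G_def x_def P in_index_iff, simp add: w_def)
  define a where "a = x 2 \<otimes>\<^bsub>G\<^esub> inv\<^bsub>G\<^esub> x 1"
  have x: "x 1 \<in> carrier G" "x 2 \<in> carrier G" using x_carrier by auto
  then have a: "a \<in> carrier G" by (simp add: a_def)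
  have rel: "a \<otimes>\<^bsub>G\<^esub> a \<otimes>\<^bsub>G\<^esub> a \<otimes>\<^bsub>G\<^esub> x 1 = x 1 \<otimes>\<^bsub>G\<^esub> a \<otimes>\<^bsub>G\<^esub> a"
    unfolding a_def by (rule BS_relation)
  \<comment> \<open>The universal property of B: a homomorphism for every pair satisfying the
    Baumslag-Solitar relation. It is used twice, with target \<open>G\<close> for the endomorphism
    and target \<open>perms\<close> for the representation.\<close>
  have lift: "\<exists>g \<in> hom G H. g (x 1) = t \<and> g (x 2) = b \<otimes>\<^bsub>H\<^esub> t"
    if H: "group H" and b: "b \<in> carrier H" and t: "t \<in> carrier H"
      and r: "b \<otimes>\<^bsub>H\<^esub> b \<otimes>\<^bsub>H\<^esub> b \<otimes>\<^bsub>H\<^esub> t = t \<otimes>\<^bsub>H\<^esub> b \<otimes>\<^bsub>H\<^esub> b"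
    for H :: "'h monoid" and b t
  proof -
    interpret H: group H by (rule H)
    let ?b = "\<lambda>i::nat. if i = 1 then t else b \<otimes>\<^bsub>H\<^esub> t"
    have b_carrier: "?b \<in> {1..2} \<rightarrow> carrier H" using b t by simp
    have rel_b: "?b i = inv\<^bsub>H\<^esub> f (w i j k) \<otimes>\<^bsub>H\<^esub> ?b j \<otimes>\<^bsub>H\<^esub> f (w i j k)"
      if f: "f \<in> hom (FG 2) H" "\<And>l. l \<in> {1..2} \<Longrightarrow> f (free_gen {1..2} l) = ?b l"
        and ijk: "(i, j, k) \<in> C_index 2 h" for f i j k
    proof -
      have i: "i = 2" and j: "j = 1" using ijk by (simp_all add: in_index_iff)
      have "f (free_gen {1..2} 1) = t" "f (free_gen {1..2} 2) = b \<otimes>\<^bsub>H\<^esub> t"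
        using f(2)[of 1] f(2)[of 2] by simp_all
      note * = hom_bs_word_relation[OF order.refl H f(1) b t r this]
      show ?thesis unfolding i j w_def by (simp, rule *)
    qed
    obtain g where g: "g \<in> hom G H" "\<And>i. i \<in> {1..2} \<Longrightarrow> g (x i) = ?b i"
      by (rule C_hom_exists[where b = ?b and m = 2 and h = h and w = w and H = H, OF P H b_carrier, folded G_def x_def])
         (rule rel_b, assumption+, rule that)
    have "g (x 1) = t" "g (x 2) = b \<otimes>\<^bsub>H\<^esub> t" using g(2)[of 1] g(2)[of 2] by simp_all
    with g(1) show ?thesis by blast
  qed
  obtain f where f: "f \<in> hom G G" "f (x 1) = x 1" "f (x 2) = a \<otimes>\<^bsub>G\<^esub> a \<otimes>\<^bsub>G\<^esub> x 1"
    using lift[OF is_group m_closed[OF a a] x(1) BS_relation_square[OF a x(1) rel]] by auto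
  obtain \<rho> where \<rho>: "\<rho> \<in> hom G perms" "\<rho> (x 1) = perm_t" "\<rho> (x 2) = perm_a \<otimes>\<^bsub>perms\<^esub> perm_t"
    using lift[OF group_BijGroup perms_facts(1-3)] by auto
  interpret BS: BS_group G perms a "x 1" "{}" f \<rho>
    by (rule BS_group_perms[OF f _ _ _ \<rho> a_def]) auto
  have "irreducible_C_presentation 2 h w"
    unfolding irreducible_C_presentation_def G_def[symmetric]
  proof (intro conjI P)
    obtain \<phi> where \<phi>: "\<phi> \<in> hom G integer_group" "\<And>i. i \<in> {1..2} \<Longrightarrow> \<phi> (x i) = 1"
      by (rule C_hom_exists_comm[where b = "\<lambda>_. 1", OF P abelian_integer_group, folded G_def x_def])
         (auto intro: that)
    \<comment> \<open>Powers of \<open>x 1\<close> already reach every integer.\<close>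
    have "\<phi> (x 1 [^]\<^bsub>G\<^esub> n) = n" for n :: int
      using hom_int_pow[OF \<phi>(1) x(1) is_group group_integer_group] \<phi>(2) by simp
    then have epi: "\<phi> \<in> epi G integer_group"
      using \<phi>(1) x by (auto simp: epi_iff_subset) (metis int_pow_closed rangeI image_eqI)
    let ?D = "derived G (carrier G)"
    interpret D: normal ?D G by (rule derived_self_is_normal)
    interpret A: comm_group "abelianization G"
      unfolding abelianization_def by (rule derived_quot_is_comm_group)
    have Dx: "?D #>\<^bsub>G\<^esub> y \<in> carrier (abelianization G)" if "y \<in> carrier G" for y
      using that by (auto simp: abelianization_def carrier_FactGroup)
    show "abelianization G \<cong> integer_group"
    \<comment> \<open>The inverse map sends n to the n-th power of the class of \<open>x 1\<close>;
      it is correct at \<open>x 2\<close> too because the two generators are conjugate.\<close>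
    proof (rule abelianization_iso[OF is_group abelian_integer_group epi
          A.hom_integer_group_pow[OF Dx[OF x(1)]] _ generate_C_gen[OF P, folded G_def x_def]])
      show "x ` {1..2} \<subseteq> carrier G" using x_carrier by auto
    next
      fix y assume "y \<in> x ` {1..2}"
      then obtain i where i: "i \<in> {1..2}" "y = x i" by auto
      have "?D #>\<^bsub>G\<^esub> x 2 = ?D #>\<^bsub>G\<^esub> x 1"
        unfolding G_def x_def using C_gen_abelianization_eq[OF P, of 2 1 1] in_index_iff by simp
      then have "?D #>\<^bsub>G\<^esub> y = ?D #>\<^bsub>G\<^esub> x 1" using i unfolding nat_2_cases by auto
      then show "(?D #>\<^bsub>G\<^esub> x 1) [^]\<^bsub>abelianization G\<^esub> \<phi> y = ?D #>\<^bsub>G\<^esub> y"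
        using Dx[OF x(1)] \<phi>(2)[OF i(1)] i(2) by simp
    qed
  qed
  with BS.not_Hopfian_not_residually_finite show ?thesis unfolding G_def by blast
qed

text \<open>The generator x_3 can be traded for the central product c = x_1 x_2 x_3. Homomorphisms
  are then built from a Baumslag-Solitar pair together with a central element, the value at
  c.\<close>

lemma Hurwitz_non_Hopfian:
  "\<exists>h w. Hurwitz_C_presentation 3 h w \<and>
     abelianization (C_group 3 h w) \<cong> integer_group \<times>\<times> integer_group \<and>
     \<not> Hopfian (C_group 3 h w) \<and> \<not> residually_finite (C_group 3 h w) \<and>
     (\<forall>k \<ge> 1. \<not> Hopfian (projective_Hurwitz_group 3 h w k) \<and>
               \<not> residually_finite (projective_Hurwitz_group 3 h w k))"
proof -
  define g3 where "g3 = free_gen {1..3::nat}"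
  \<comment> \<open>Bracketed to the right to match the \<open>foldr\<close> in
    \<open>C_product\<close>.\<close>
  define cw where "cw = g3 1 \<otimes>\<^bsub>FG 3\<^esub> (g3 2 \<otimes>\<^bsub>FG 3\<^esub> g3 3)"
  \<comment> \<open>Besides (2, 1), each diagonal index carries one relation. Its conjugating word
    is \<open>cw\<close>, so it says that x_i commutes with the product.\<close>
  define h :: "nat \<Rightarrow> nat \<Rightarrow> int" where "h = (\<lambda>i j. if i = 2 \<and> j = 1 \<or> i = j then 1 else 0)"
  define w :: "nat \<Rightarrow> nat \<Rightarrow> int \<Rightarrow> (nat \<times> bool) list set" where
    "w = (\<lambda>i j _. if i = j then cw else bs_word 3)"
  define G where "G = C_group 3 h w"
  define x where "x = C_gen 3 h w"
  have in_index_iff: "(i, j, k) \<in> C_index 3 h \<longleftrightarrow> (i = 2 \<and> j = 1 \<or> i = j \<and> i \<in> {1..3}) \<and> k = 1" for i j k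
    by (auto simp: C_index_def h_def split: if_splits)
  have g3: "g3 1 \<in> carrier (FG 3)" "g3 2 \<in> carrier (FG 3)" "g3 3 \<in> carrier (FG 3)"
    unfolding g3_def by (auto intro!: free_gen_carrier)
  interpret F: group "FG 3" by (rule group_free_group)
  have cw: "cw \<in> carrier (FG 3)" unfolding cw_def using g3 by (intro F.m_closed)
  have P: "C_presentation 3 h w"
    using cw by (auto simp: C_presentation_def w_def bs_word_carrier simp del: One_nat_def)
  interpret BS_C_group 3 h w G x
    by unfold_locales (simp_all add: G_def x_def P in_index_iff, simp add: w_def)
  define a where "a = x 2 \<otimes>\<^bsub>G\<^esub> inv\<^bsub>G\<^esub> x 1"
  define c where "c = x 1 \<otimes>\<^bsub>G\<^esub> (x 2 \<otimes>\<^bsub>G\<^esub> x 3)"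
  have x: "x 1 \<in> carrier G" "x 2 \<in> carrier G" "x 3 \<in> carrier G" using x_carrier by auto
  then have a: "a \<in> carrier G" and c: "c \<in> carrier G" by (simp_all add: a_def c_def)
  have x2: "x 2 = a \<otimes>\<^bsub>G\<^esub> x 1" using x by (simp add: a_def m_assoc)
  have x3: "x 3 = inv\<^bsub>G\<^esub> (x 1 \<otimes>\<^bsub>G\<^esub> x 2) \<otimes>\<^bsub>G\<^esub> c"
    using x inv_solve_left[of "x 3" "x 1 \<otimes>\<^bsub>G\<^esub> x 2" c] by (simp add: c_def m_assoc)
  have rel: "a \<otimes>\<^bsub>G\<^esub> a \<otimes>\<^bsub>G\<^esub> a \<otimes>\<^bsub>G\<^esub> x 1 = x 1 \<otimes>\<^bsub>G\<^esub> a \<otimes>\<^bsub>G\<^esub> a"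
    unfolding a_def by (rule BS_relation)
  have hom_cw: "f cw = f (g3 1) \<otimes>\<^bsub>H\<^esub> (f (g3 2) \<otimes>\<^bsub>H\<^esub> f (g3 3))" if "f \<in> hom (FG 3) H"
    for f and H :: "'h monoid"
    unfolding cw_def hom_mult[OF that g3(1) F.m_closed[OF g3(2,3)]] hom_mult[OF that g3(2,3)] ..
  have gen: "generate G (x ` {1..3}) = carrier G"
    using generate_C_gen[OF P] by (simp only: G_def x_def)
  have c_proj: "normal_closure (FG 3) (C_relators 3 h w) #>\<^bsub>FG 3\<^esub> cw = c"
    using hom_cw[OF C_proj_hom[OF P]] by (simp only: c_def G_def x_def C_gen_def g3_def)
  have c_comm_x: "c \<otimes>\<^bsub>G\<^esub> x i = x i \<otimes>\<^bsub>G\<^esub> c" if i: "i \<in> {1..3}" for i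
  proof -
    have "x i = inv\<^bsub>G\<^esub> c \<otimes>\<^bsub>G\<^esub> x i \<otimes>\<^bsub>G\<^esub> c"
    proof -
      have "(i, i, 1) \<in> C_index 3 h" using i by (simp add: in_index_iff)
      moreover have "w i i 1 = cw" by (simp add: w_def)
      ultimately show ?thesis
        using C_group_relation[OF P, folded G_def x_def, of i i 1] c_proj by simp
    qed
    then have "x i = inv\<^bsub>G\<^esub> c \<otimes>\<^bsub>G\<^esub> (x i \<otimes>\<^bsub>G\<^esub> c)"
      using x_carrier[OF i] c by (simp only: m_assoc inv_closed)
    then show ?thesis
      using inv_solve_left[of "x i" c "x i \<otimes>\<^bsub>G\<^esub> c"] x_carrier[OF i] c by simp
  qed
  have c_comm: "c \<otimes>\<^bsub>G\<^esub> y = y \<otimes>\<^bsub>G\<^esub> c" if "y \<in> carrier G" for y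
  proof (rule commute_generate[OF c _ _ that[folded gen]])
    show "x ` {1..3} \<subseteq> carrier G" using x_carrier by blast
    show "c \<otimes>\<^bsub>G\<^esub> s = s \<otimes>\<^bsub>G\<^esub> c" if "s \<in> x ` {1..3}" for s
      using that c_comm_x by blast
  qed
  have product: "C_product 3 h w = c"
  proof -
    have "[1..<Suc 3] = [1, 2, 3]" by (simp add: upt_rec)
    then show ?thesis
      unfolding C_product_def using x by (simp add: c_def flip: G_def x_def)
  qed
  \<comment> \<open>The universal property of B times the integers: a Baumslag-Solitar pair and a
    central element \<open>z\<close> prescribing the value at \<open>c\<close>.\<close>
  have lift: "\<exists>g \<in> hom G H. g (x 1) = t \<and> g (x 2) = b \<otimes>\<^bsub>H\<^esub> t \<and> g c = z"
    if H: "group H" and b: "b \<in> carrier H" and t: "t \<in> carrier H"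
      and r: "b \<otimes>\<^bsub>H\<^esub> b \<otimes>\<^bsub>H\<^esub> b \<otimes>\<^bsub>H\<^esub> t = t \<otimes>\<^bsub>H\<^esub> b \<otimes>\<^bsub>H\<^esub> b"
      and z: "z \<in> carrier H" "\<And>y. y \<in> carrier H \<Longrightarrow> z \<otimes>\<^bsub>H\<^esub> y = y \<otimes>\<^bsub>H\<^esub> z"
    for H :: "'h monoid" and b t z
  proof -
    interpret H: group H by (rule H)
    \<comment> \<open>This is the value of x_1 x_2. Sending x_3 to u^-1 z makes the whole product go
      to \<open>z\<close>.\<close>
    define u where "u = t \<otimes>\<^bsub>H\<^esub> (b \<otimes>\<^bsub>H\<^esub> t)"
    have u: "u \<in> carrier H" using b t by (simp add: u_def)
    let ?b = "\<lambda>i::nat. if i = 1 then t else if i = 2 then b \<otimes>\<^bsub>H\<^esub> t else inv\<^bsub>H\<^esub> u \<otimes>\<^bsub>H\<^esub> z"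
    have b_carrier: "?b \<in> {1..3} \<rightarrow> carrier H" using b t u z by simp
    have prod: "t \<otimes>\<^bsub>H\<^esub> (b \<otimes>\<^bsub>H\<^esub> t \<otimes>\<^bsub>H\<^esub> (inv\<^bsub>H\<^esub> u \<otimes>\<^bsub>H\<^esub> z)) = z"
    proof -
      have "t \<otimes>\<^bsub>H\<^esub> (b \<otimes>\<^bsub>H\<^esub> t \<otimes>\<^bsub>H\<^esub> (inv\<^bsub>H\<^esub> u \<otimes>\<^bsub>H\<^esub> z)) = u \<otimes>\<^bsub>H\<^esub> (inv\<^bsub>H\<^esub> u \<otimes>\<^bsub>H\<^esub> z)"
        using b t u z(1) by (simp add: u_def H.m_assoc)
      also have "\<dots> = z" using u z(1) by (simp add: H.m_assoc[symmetric])
      finally show ?thesis .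
    qed
    have rel_b: "?b i = inv\<^bsub>H\<^esub> f (w i j k) \<otimes>\<^bsub>H\<^esub> ?b j \<otimes>\<^bsub>H\<^esub> f (w i j k)"
      if f: "f \<in> hom (FG 3) H" "\<And>l. l \<in> {1..3} \<Longrightarrow> f (free_gen {1..3} l) = ?b l"
        and ijk: "(i, j, k) \<in> C_index 3 h" for f i j k
    proof (cases "i = j")
      case True
      have "f cw = z"
        unfolding hom_cw[OF f(1)] g3_def using f(2)[of 1] f(2)[of 2] f(2)[of 3] prod by simp
      moreover have "y = inv\<^bsub>H\<^esub> z \<otimes>\<^bsub>H\<^esub> y \<otimes>\<^bsub>H\<^esub> z" if "y \<in> carrier H" for y
        using H.inv_solve_left[of y z "y \<otimes>\<^bsub>H\<^esub> z"] z that by (simp add: H.m_assoc)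
      ultimately show ?thesis using True b t u z(1) by (auto simp: w_def)
    next
      case False
      then have i: "i = 2" and j: "j = 1" using ijk by (simp_all add: in_index_iff)
      have "f (free_gen {1..3} 1) = t" "f (free_gen {1..3} 2) = b \<otimes>\<^bsub>H\<^esub> t"
        using f(2)[of 1] f(2)[of 2] by simp_all
      note * = hom_bs_word_relation[OF _ H f(1) b t r this]
      show ?thesis unfolding i j w_def by (simp, rule *) simp
    qed
    obtain g where g: "g \<in> hom G H" "\<And>i. i \<in> {1..3} \<Longrightarrow> g (x i) = ?b i"
      by (rule C_hom_exists[where b = ?b and m = 3 and h = h and w = w and H = H, OF P H b_carrier, folded G_def x_def])
         (rule rel_b, assumption+, rule that)
    have "g c = z"
      unfolding c_def hom_mult[OF g(1) x(1) m_closed[OF x(2,3)]] hom_mult[OF g(1) x(2,3)]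
      using g(2)[of 1] g(2)[of 2] g(2)[of 3] prod by simp
    moreover have "g (x 1) = t" "g (x 2) = b \<otimes>\<^bsub>H\<^esub> t" using g(2)[of 1] g(2)[of 2] by simp_all
    ultimately show ?thesis using g(1) by blast
  qed
  \<comment> \<open>The endomorphism squares \<open>a\<close> and takes z = c, so that it fixes
    \<open>c\<close>; the representation after it takes z = 1, so that it kills
    \<open>c\<close>.\<close>
  obtain f where f: "f \<in> hom G G" "f (x 1) = x 1" "f (x 2) = a \<otimes>\<^bsub>G\<^esub> a \<otimes>\<^bsub>G\<^esub> x 1" "f c = c"
    using lift[OF is_group m_closed[OF a a] x(1) BS_relation_square[OF a x(1) rel] c c_comm] by auto
  obtain \<rho> where \<rho>: "\<rho> \<in> hom G perms" "\<rho> (x 1) = perm_t" "\<rho> (x 2) = perm_a \<otimes>\<^bsub>perms\<^esub> perm_t"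
    "\<rho> c = \<one>\<^bsub>perms\<^esub>"
    using lift[OF group_BijGroup perms_facts(1-3), of "\<one>\<^bsub>perms\<^esub>"]
    by (auto simp: group.is_monoid[OF group_BijGroup] monoid.one_closed monoid.l_one monoid.r_one)
  have sub: "subgroup (generate G ({a, x 1} \<union> {c})) G"
    using a x c by (intro generate_is_subgroup) simp
  have incl: "a \<in> generate G ({a, x 1} \<union> {c})" "x 1 \<in> generate G ({a, x 1} \<union> {c})"
    "c \<in> generate G ({a, x 1} \<union> {c})" by (auto intro: generate.incl)
  then have "x 3 \<in> generate G ({a, x 1} \<union> {c})"
    unfolding x3 x2
    by (intro subgroup.m_closed[OF sub] subgroup.m_inv_closed[OF sub])
  then have x3_gen: "x ` {3..3} \<subseteq> generate G ({a, x 1} \<union> {c})" by simp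
  interpret BS: BS_group G perms a "x 1" "{c}" f \<rho>
    by (rule BS_group_perms[OF f(1-3) _ _ x3_gen \<rho>(1-3) a_def]) (use f c in auto)
  \<comment> \<open>These are the three conditions on \<open>r\<close> in the quotient lemma, for r
    = c^k.\<close>
  have ck: "c [^]\<^bsub>G\<^esub> k \<in> carrier G" "f (c [^]\<^bsub>G\<^esub> k) = c [^]\<^bsub>G\<^esub> k" "\<rho> (c [^]\<^bsub>G\<^esub> k) = \<one>\<^bsub>perms\<^esub>"
    for k :: nat
    using c f(4) \<rho>(4) BS.H.nat_pow_one by (simp_all add: BS.f.hom_nat_pow BS.\<rho>.hom_nat_pow)
  have proj: "\<not> Hopfian (projective_Hurwitz_group 3 h w k)"
    "\<not> residually_finite (projective_Hurwitz_group 3 h w k)" for k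
    using BS.quotient_not_Hopfian_not_residually_finite[OF ck]
    by (simp_all add: projective_Hurwitz_group_def product G_def)
  have Hurwitz: "Hurwitz_C_presentation 3 h w"
    using P gen product c c_comm by (simp add: Hurwitz_C_presentation_def center_def G_def x_def)
  have ab: "abelianization G \<cong> integer_group \<times>\<times> integer_group"
  proof -
    \<comment> \<open>The first map counts x_1 and x_2 together, the second counts x_3. Both respect
      the relations, since x_1 and x_2 are the only distinct generators identified up to
      conjugacy.\<close>
    obtain \<phi>1 where \<phi>1: "\<phi>1 \<in> hom G integer_group"
      "\<And>i. i \<in> {1..3} \<Longrightarrow> \<phi>1 (x i) = (if i = 3 then 0 else 1)"
      by (rule C_hom_exists_comm[where b = "\<lambda>i. if i = 3 then 0 else 1", OF P abelian_integer_group,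
            folded G_def x_def])
         (auto intro: that simp: in_index_iff)
    obtain \<phi>2 where \<phi>2: "\<phi>2 \<in> hom G integer_group"
      "\<And>i. i \<in> {1..3} \<Longrightarrow> \<phi>2 (x i) = (if i = 3 then 1 else 0)"
      by (rule C_hom_exists_comm[where b = "\<lambda>i. if i = 3 then 1 else 0", OF P abelian_integer_group,
            folded G_def x_def])
         (auto intro: that simp: in_index_iff)
    define \<phi> where "\<phi> = (\<lambda>y. (\<phi>1 y, \<phi>2 y))"
    have \<phi>: "\<phi> \<in> hom G (integer_group \<times>\<times> integer_group)"
      unfolding \<phi>_def hom_paired using \<phi>1 \<phi>2 by simp
    have "\<phi> (x 1 [^]\<^bsub>G\<^esub> m \<otimes>\<^bsub>G\<^esub> x 3 [^]\<^bsub>G\<^esub> n) = (m, n)" for m n :: int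
      using x \<phi>1(2)[of 1] \<phi>1(2)[of 3] \<phi>2(2)[of 1] \<phi>2(2)[of 3]
      by (simp add: \<phi>_def hom_mult[OF \<phi>1(1)] hom_mult[OF \<phi>2(1)]
          hom_int_pow[OF \<phi>1(1) _ is_group group_integer_group]
          hom_int_pow[OF \<phi>2(1) _ is_group group_integer_group])
    then have "(m, n) \<in> \<phi> ` carrier G" for m n
      using x by (metis int_pow_closed m_closed image_eqI)
    then have epi: "\<phi> \<in> epi G (integer_group \<times>\<times> integer_group)"
      using \<phi> by (auto simp: epi_iff_subset)
    let ?D = "derived G (carrier G)"
    let ?A = "abelianization G"
    interpret D: normal ?D G by (rule derived_self_is_normal)
    interpret A: comm_group ?A
      unfolding abelianization_def by (rule derived_quot_is_comm_group)
    have Dx: "?D #>\<^bsub>G\<^esub> y \<in> carrier ?A" if "y \<in> carrier G" for y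
      using that by (auto simp: abelianization_def carrier_FactGroup)
    \<comment> \<open>The inverse map: the classes of \<open>x 1\<close> and \<open>x 3\<close>
      serve as a basis of the abelianization.\<close>
    define \<sigma> where "\<sigma> = (\<lambda>(m::int, n::int).
      (?D #>\<^bsub>G\<^esub> x 1) [^]\<^bsub>?A\<^esub> m \<otimes>\<^bsub>?A\<^esub> (?D #>\<^bsub>G\<^esub> x 3) [^]\<^bsub>?A\<^esub> n)"
    have \<sigma>: "\<sigma> \<in> hom (integer_group \<times>\<times> integer_group) ?A"
    proof (rule homI)
      fix p assume "p \<in> carrier (integer_group \<times>\<times> integer_group)"
      obtain m n where p: "p = (m, n)" by (cases p)
      show "\<sigma> p \<in> carrier ?A" using Dx x by (simp add: \<sigma>_def p)
      fix q assume "q \<in> carrier (integer_group \<times>\<times> integer_group)"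
      obtain m' n' where q: "q = (m', n')" by (cases q)
      show "\<sigma> (p \<otimes>\<^bsub>integer_group \<times>\<times> integer_group\<^esub> q) = \<sigma> p \<otimes>\<^bsub>?A\<^esub> \<sigma> q"
        using Dx x by (simp add: \<sigma>_def p q A.int_pow_mult A.m_ac)
    qed
    have comm: "comm_group (integer_group \<times>\<times> integer_group)"
      by (rule group.group_comm_groupI[OF DirProd_group]) auto
    show ?thesis
    proof (rule abelianization_iso[OF is_group comm epi \<sigma> _ gen])
      show "x ` {1..3} \<subseteq> carrier G" using x_carrier by auto
    next
      fix y assume "y \<in> x ` {1..3}"
      then obtain i where i: "i \<in> {1..3}" "y = x i" by auto
      have D2: "?D #>\<^bsub>G\<^esub> x 2 = ?D #>\<^bsub>G\<^esub> x 1"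
        unfolding G_def x_def using C_gen_abelianization_eq[OF P, of 2 1 1] in_index_iff by simp
      show "\<sigma> (\<phi> y) = ?D #>\<^bsub>G\<^esub> y"
        using Dx x i D2 \<phi>1(2)[OF i(1)] \<phi>2(2)[OF i(1)] unfolding nat_3_cases
        by (auto simp: \<sigma>_def \<phi>_def)
    qed
  qed
  show ?thesis
    using Hurwitz ab BS.not_Hopfian_not_residually_finite proj unfolding G_def by blast
qed

theorem theorem0p6:
  shows "(\<exists>m h w. irreducible_C_presentation m h w \<and>
            \<not> Hopfian (C_group m h w) \<and> \<not> residually_finite (C_group m h w)) \<and>
         (\<exists>h w. Hurwitz_C_presentation 3 h w \<and>
            abelianization (C_group 3 h w) \<cong> integer_group \<times>\<times> integer_group \<and>
            \<not> Hopfian (C_group 3 h w) \<and> \<not> residually_finite (C_group 3 h w) \<and>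
            (\<forall>k \<ge> 1. \<not> Hopfian (projective_Hurwitz_group 3 h w k) \<and>
                      \<not> residually_finite (projective_Hurwitz_group 3 h w k)))"
  using irreducible_non_Hopfian Hurwitz_non_Hopfian by (rule conjI)

end
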